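(* Let $0<p\le q$, $n=p+q$, $\alpha\in\mathbb{R}$, and let $g\in\mathcal{L}^-\mathrm{U}_{p,q}$ be a negative algebraic loop whose only singularity is at $\alpha$. If $p=q$, then $g$ can be written as a product of nilpotent loops of type $m_{\alpha,k,N}$. If $p\ne q$, then $g$ can be written as a product of nilpotent loops of types $m_{\alpha,k,N}$ and $n_{\alpha,k,N}$. Here: (1) $m_{\alpha,k,N}(\lambda)=\mathrm{I}+\left(\frac{1}{\lambda-\alpha}\right)^kN$ with $k\in\mathbb{N}$, $N^2=0$, $N^*=-N$, $\operatorname{rank}N=1$; (2) $n_{\alpha,k,N}(\lambda)=\mathrm{I}+\left(\frac{1}{\lambda-\alpha}\right)^kN+\frac12\left(\frac{1}{\lambda-\alpha}\right)^{2k}N^2$ with $k\in\mathbb{N}$, $N=M-M^*$, where $M:(V\oplus sV)^\perp\to V$ is linear for some maximal isotropic subspace $V$, $\operatorname{rank}M=1$, $\operatorname{rank}N=2$.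
   Context: On $\mathbb{C}^n$, $n=p+q$, let $\langle v,w\rangle=-\sum_{i=1}^p\overline{v_i}w_i+\sum_{i=p+1}^{p+q}\overline{v_i}w_i$. The symbol $\perp$ refers to orthogonality with respect to $\langle\cdot,\cdot\rangle$; a subspace is isotropic if $\langle\cdot,\cdot\rangle$ vanishes identically on it, and maximal isotropic if it is maximal among isotropic subspaces. Put $s=\mathrm{diag}(-\mathrm{I}_p,\mathrm{I}_q)$; $A^*=s\bar A^t s$ is the adjoint with respect to $\langle\cdot,\cdot\rangle$. $\mathcal{L}^-\mathrm{GL}_n\mathbb{C}$ is the group of all non-degenerate (determinant not identically zero) $n\times n$ matrices $g(\lambda)$ of complex rational functions with $g(\infty)=\mathrm{I}$, and $\mathcal{L}^-\mathrm{U}_{p,q}$ is its subgroup of loops satisfying the $\mathrm{U}_{p,q}$-reality condition $(g(\bar\lambda)^* )^{-1}=g(\lambda)$. A point is a pole of $g$ if it is a pole of some matrix entry; a non-pole $\mu$ is a zero of $g$ if $g(\mu)$ is singular; a singularity is a pole or a zero. A negative algebraic loop with only singularity at $\alpha$ has the form $g(\lambda)=(\lambda-\alpha)^{-r}A_r+\dots+(\lambda-\alpha)^{-1}A_1+\mathrm{I}$ with $r\ge1$, $A_r\ne0$. For isotropic $V$ there is a direct sum decomposition $\mathbb{C}^n=V\oplus(V\oplus sV)^\perp\oplus sV$; a linear map $M:(V\oplus sV)^\perp\to V$ is regarded as an endomorphism of $\mathbb{C}^n$ by extending it by zero on $V\oplus sV$, and $M^*$ is the adjoint of this endomorphism. $\mathbb{N}$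 denotes the positive integers. *)

theory Defs
  imports
    "HOL-Analysis.Analysis"
    "HOL-Computational_Algebra.Computational_Algebra"
    "HOL-Computational_Algebra.Field_as_Ring"
begin

text \<open>
  The index set \<open>{1, \<dots>, p + q}\<close> is rendered as the disjoint sum of two finite types \<open>'p\<close> and
  \<open>'q\<close> with \<open>p = CARD('p)\<close> and \<open>q = CARD('q)\<close>: the indices \<open>Inl i\<close> are the first \<open>p\<close> ones, the
  indices \<open>Inr i\<close> the last \<open>q\<close> ones.  Types are nonempty, so \<open>p > 0\<close> and \<open>q > 0\<close> always hold.
\<close>

section \<open>The indefinite Hermitian form on \<open>\<complex>\<^sup>n\<close>\<close>

definition pq_form :: "complex ^ ('p::finite + 'q::finite) \<Rightarrow> complex ^ ('p + 'q) \<Rightarrow> complex" where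
  "pq_form v w = - (\<Sum>i\<in>UNIV. cnj (v $ Inl i) * w $ Inl i) + (\<Sum>i\<in>UNIV. cnj (v $ Inr i) * w $ Inr i)"

definition perp :: "(complex ^ ('p::finite + 'q::finite)) set \<Rightarrow> (complex ^ ('p + 'q)) set" where
  "perp U = {w. \<forall>v\<in>U. pq_form v w = 0}"

text \<open>\<open>vec.subspace\<close> is the notion of a complex linear subspace; \<open>subspace\<close> would be the real one.\<close>

definition isotropic :: "(complex ^ ('p::finite + 'q::finite)) set \<Rightarrow> bool" where
  "isotropic V \<longleftrightarrow> vec.subspace V \<and> (\<forall>v\<in>V. \<forall>w\<in>V. pq_form v w = 0)"

definition maximal_isotropic :: "(complex ^ ('p::finite + 'q::finite)) set \<Rightarrow> bool" where
  "maximal_isotropic V \<longleftrightarrow> isotropic V \<and> (\<forall>W. isotropic W \<longrightarrow> V \<subseteq> W \<longrightarrow> W = V)"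

definition sig_mat :: "complex ^ ('p::finite + 'q::finite) ^ ('p + 'q)" where
  "sig_mat = (\<chi> i j. if i = j then (case i of Inl _ \<Rightarrow> - 1 | Inr _ \<Rightarrow> 1) else 0)"

definition adj :: "complex ^ ('p::finite + 'q::finite) ^ ('p + 'q) \<Rightarrow> complex ^ ('p + 'q) ^ ('p + 'q)" where
  "adj A = sig_mat ** transpose (map_matrix cnj A) ** sig_mat"

definition V_plus_sV :: "(complex ^ ('p::finite + 'q::finite)) set \<Rightarrow> (complex ^ ('p + 'q)) set" where
  "V_plus_sV V = {v + sig_mat *v w |v w. v \<in> V \<and> w \<in> V}"


section \<open>Rational loops\<close>

type_synonym ratfun = "complex poly fract"

text \<open>
  \<open>quot_of_fract f\<close> is the pair of numerator and denominator of \<open>f\<close> in lowest terms, so the poles of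
  \<open>f\<close> are the roots of the denominator.  \<open>rat_value f \<mu>\<close> is meaningful only if \<open>\<mu>\<close> is not a pole.
\<close>

definition rat_pole :: "ratfun \<Rightarrow> complex \<Rightarrow> bool" where
  "rat_pole f \<mu> \<longleftrightarrow> poly (snd (quot_of_fract f)) \<mu> = 0"

definition rat_value :: "ratfun \<Rightarrow> complex \<Rightarrow> complex" where
  "rat_value f \<mu> = poly (fst (quot_of_fract f)) \<mu> / poly (snd (quot_of_fract f)) \<mu>"

definition loop_value :: "ratfun ^ 'n ^ 'm \<Rightarrow> complex \<Rightarrow> complex ^ 'n ^ 'm" where
  "loop_value g \<mu> = map_matrix (\<lambda>f. rat_value f \<mu>) g"

definition loop_pole :: "ratfun ^ 'n ^ 'n \<Rightarrow> complex \<Rightarrow> bool" where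
  "loop_pole g \<mu> \<longleftrightarrow> (\<exists>i j. rat_pole (g $ i $ j) \<mu>)"

definition loop_zero :: "ratfun ^ 'n ^ 'n \<Rightarrow> complex \<Rightarrow> bool" where
  "loop_zero g \<mu> \<longleftrightarrow> \<not> loop_pole g \<mu> \<and> \<not> invertible (loop_value g \<mu>)"

definition loop_singularity :: "ratfun ^ 'n ^ 'n \<Rightarrow> complex \<Rightarrow> bool" where
  "loop_singularity g \<mu> \<longleftrightarrow> loop_pole g \<mu> \<or> loop_zero g \<mu>"

text \<open>
  \<open>g(\<infinity>) = I\<close> is expressed as a limit; a rational function is regular at \<open>\<infinity>\<close> with value \<open>c\<close> iff it
  tends to \<open>c\<close> there.
\<close>

definition neg_loops_GL :: "(ratfun ^ 'n ^ 'n) set" where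
  "neg_loops_GL = {g. det g \<noteq> 0 \<and> (loop_value g \<longlongrightarrow> mat 1) at_infinity}"

text \<open>
  The reality condition is an identity of rational functions; it is stated at all points where both
  sides are defined by evaluation, which excludes only finitely many \<open>\<mu>\<close> since \<open>det g \<noteq> 0\<close>.
\<close>

definition neg_loops_U :: "(ratfun ^ ('p::finite + 'q::finite) ^ ('p + 'q)) set" where
  "neg_loops_U = {g \<in> neg_loops_GL. \<forall>\<mu>. \<not> loop_singularity g \<mu> \<longrightarrow> \<not> loop_singularity g (cnj \<mu>) \<longrightarrow>
     matrix_inv (adj (loop_value g (cnj \<mu>))) = loop_value g \<mu>}"


section \<open>Nilpotent loops\<close>

definition const_rat :: "complex \<Rightarrow> ratfun" where
  "const_rat c = to_fract [:c:]"

definition inv_lin :: "complex \<Rightarrow> ratfun" where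
  "inv_lin \<alpha> = 1 / to_fract [:- \<alpha>, 1:]"

definition m_loop :: "complex \<Rightarrow> nat \<Rightarrow> complex ^ 'n ^ 'n \<Rightarrow> ratfun ^ 'n ^ 'n" where
  "m_loop \<alpha> k N = mat 1 + map_matrix (\<lambda>c. inv_lin \<alpha> ^ k * const_rat c) N"

definition n_loop :: "complex \<Rightarrow> nat \<Rightarrow> complex ^ 'n ^ 'n \<Rightarrow> ratfun ^ 'n ^ 'n" where
  "n_loop \<alpha> k N = mat 1 + map_matrix (\<lambda>c. inv_lin \<alpha> ^ k * const_rat c) N
     + map_matrix (\<lambda>c. 1 / 2 * inv_lin \<alpha> ^ (2 * k) * const_rat c) (N ** N)"

definition m_type_loops :: "complex \<Rightarrow> (ratfun ^ ('p::finite + 'q::finite) ^ ('p + 'q)) set" where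
  "m_type_loops \<alpha> = {m_loop \<alpha> k N |k N. k \<ge> 1 \<and> N ** N = 0 \<and> adj N = - N \<and> rank N = 1}"

text \<open>
  A linear map \<open>M : (V \<oplus> sV)\<^sup>\<bottom> \<rightarrow> V\<close>, extended by zero, is a matrix vanishing on \<open>V \<oplus> sV\<close> and mapping
  \<open>(V \<oplus> sV)\<^sup>\<bottom>\<close> into \<open>V\<close>.
\<close>

definition n_type_loops :: "complex \<Rightarrow> (ratfun ^ ('p::finite + 'q::finite) ^ ('p + 'q)) set" where
  "n_type_loops \<alpha> = {n_loop \<alpha> k N |k N. k \<ge> 1 \<and>
     (\<exists>V M. maximal_isotropic V \<and>
        (\<forall>x\<in>V_plus_sV V. M *v x = 0) \<and> (\<forall>x\<in>perp (V_plus_sV V). M *v x \<in> V) \<and>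
        rank M = 1 \<and> N = M - adj M \<and> rank N = 2)}"

definition loop_product :: "(ratfun ^ 'n ^ 'n) list \<Rightarrow> ratfun ^ 'n ^ 'n" where
  "loop_product gs = foldr (**) gs (mat 1)"

end

theory Submission
  imports Defs
begin

text \<open>
  In the variable \<open>t = 1 / (\<lambda> - \<alpha>)\<close> a loop whose only singularity is the real point \<open>\<alpha>\<close> is a matrix
  polynomial \<open>P\<close> with \<open>P(0) = I\<close> which preserves the Hermitian form extended to polynomial vectors.
  The loops \<open>m\<close> and \<open>n\<close> become unipotent isometries with respect to a constant isotropic vector \<open>v\<close>:
  the transvection along \<open>t\<^sup>k v\<close>, and the Siegel transformation of \<open>t\<^sup>k v\<close> and a constant \<open>w \<perp> v\<close>.

  The heart of the matter is a Euclidean algorithm for \<open>x = P e\<close> with \<open>e\<close> constant and isotropic.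
  The leading coefficient \<open>v\<close> of \<open>x\<close> is isotropic, and at most one Siegel transformation and one
  transvection, both along this \<open>v\<close>, lower the degree; so some product \<open>u\<close> of such isometries
  satisfies \<open>u x = e\<close>. Once \<open>e\<close> is fixed, a further product fixes a vector dual to \<open>e\<close>, and
  one continues in the orthogonal complement of this hyperbolic plane. After \<open>p\<close> planes the form
  is definite on the complement, where polynomial isometries are constant.

  Finally, if \<open>p \<ge> 2\<close> then \<open>v\<^sup>\<perp>\<close> is spanned by isotropic vectors and Siegel transformations with
  isotropic \<open>w\<close> are products of transvections. If \<open>p = 1\<close> then the line of \<open>v\<close> is maximal isotropic,
  and a Siegel transformation is a loop of type \<open>n\<close> up to transvections.
\<close>

unbundle no fps_syntax

section \<open>The Hermitian form as a signed sum over all indices\<close>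

definition pq_sign :: "'p + 'q \<Rightarrow> complex" where
  "pq_sign a = (case a of Inl _ \<Rightarrow> - 1 | Inr _ \<Rightarrow> 1)"

lemma cnj_pq_sign [simp]: "cnj (pq_sign a) = pq_sign a"
  by (simp add: pq_sign_def split: sum.split)

lemma pq_sign_square [simp]: "pq_sign a * pq_sign a = 1"
  by (simp add: pq_sign_def split: sum.split)

lemma sum_UNIV_Plus:
  "(\<Sum>a\<in>UNIV. f a) = (\<Sum>i\<in>UNIV. f (Inl i)) + (\<Sum>i\<in>UNIV. f (Inr i))"
  for f :: "'p::finite + 'q::finite \<Rightarrow> 'a::comm_monoid_add"
  unfolding UNIV_Plus_UNIV[symmetric] by (subst sum.Plus) (auto simp: o_def)

lemma pq_form_altdef: "pq_form v w = (\<Sum>a\<in>UNIV. pq_sign a * cnj (v $ a) * w $ a)"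
  by (simp add: pq_form_def sum_UNIV_Plus pq_sign_def sum_negf)

lemma pq_form_add_left: "pq_form (u + v) w = pq_form u w + pq_form v w"
  by (simp add: pq_form_altdef algebra_simps sum.distrib)

lemma pq_form_add_right: "pq_form w (u + v) = pq_form w u + pq_form w v"
  by (simp add: pq_form_altdef algebra_simps sum.distrib)

lemma pq_form_diff_left: "pq_form (u - v) w = pq_form u w - pq_form v w"
  by (simp add: pq_form_altdef algebra_simps sum_subtractf)

lemma pq_form_diff_right: "pq_form w (u - v) = pq_form w u - pq_form w v"
  by (simp add: pq_form_altdef algebra_simps sum_subtractf)

lemma pq_form_scale_left: "pq_form (c *s v) w = cnj c * pq_form v w"
  by (simp add: pq_form_altdef sum_distrib_left mult_ac)

lemma pq_form_scale_right: "pq_form v (c *s w) = c * pq_form v w"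
  by (simp add: pq_form_altdef sum_distrib_left mult_ac)

lemma pq_form_zero [simp]: "pq_form 0 w = 0" "pq_form v 0 = 0"
  by (simp_all add: pq_form_altdef)

lemma pq_form_minus: "pq_form (- v) w = - pq_form v w" "pq_form v (- w) = - pq_form v w"
  by (simp_all add: pq_form_altdef sum_negf)

lemmas pq_form_linear = pq_form_add_left pq_form_add_right pq_form_diff_left pq_form_diff_right
  pq_form_scale_left pq_form_scale_right pq_form_minus

lemma pq_form_cnj: "cnj (pq_form v w) = pq_form w v"
  by (simp add: pq_form_altdef mult_ac)

lemma pq_form_eq_0_sym: "pq_form v w = 0 \<Longrightarrow> pq_form w v = 0"
  using pq_form_cnj[of v w] by simp

lemma pq_form_self_Re: "pq_form v v = of_real (Re (pq_form v v))"
  using pq_form_cnj[of v v] by (simp add: complex_eq_iff)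

lemma pq_form_axis: "pq_form (axis a c) w = pq_sign a * cnj c * w $ a"
proof -
  have "pq_form (axis a c) w = (\<Sum>b\<in>UNIV. if b = a then pq_sign a * cnj c * w $ a else 0)"
    unfolding pq_form_altdef by (rule sum.cong) (auto simp: axis_def)
  then show ?thesis by simp
qed

section \<open>Polynomial vectors\<close>

definition const_vec :: "complex ^ 'n \<Rightarrow> complex poly ^ 'n" where
  "const_vec v = (\<chi> a. [:v $ a:])"

definition coeff_vec :: "complex poly ^ 'n \<Rightarrow> nat \<Rightarrow> complex ^ 'n" where
  "coeff_vec x k = (\<chi> a. coeff (x $ a) k)"

text \<open>Only coefficients are conjugated, so the variable \<open>t\<close> counts as real. For
  real \<open>\<alpha>\<close> this is the conjugation that occurs in the reality condition.\<close>

definition poly_form :: "complex poly ^ ('p::finite + 'q::finite) \<Rightarrow> complex poly ^ ('p + 'q) \<Rightarrow> complex poly"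
  where "poly_form x y = (\<Sum>a\<in>UNIV. [:pq_sign a:] * map_poly cnj (x $ a) * y $ a)"

lemma map_poly_cnj_add: "map_poly cnj (p + q) = map_poly cnj p + map_poly cnj q"
  by (rule poly_eqI) (simp add: coeff_map_poly)

lemma map_poly_cnj_diff: "map_poly cnj (p - q) = map_poly cnj p - map_poly cnj q"
  by (rule poly_eqI) (simp add: coeff_map_poly)

lemma map_poly_cnj_mult: "map_poly cnj (p * q) = map_poly cnj p * map_poly cnj q"
  by (rule poly_eqI) (simp add: coeff_map_poly coeff_mult)

lemma map_poly_cnj_monom: "map_poly cnj (monom c k) = monom (cnj c) k"
  by (rule poly_eqI) (simp add: coeff_map_poly)

lemma poly_form_add_right: "poly_form w (u + v) = poly_form w u + poly_form w v"
  by (simp add: poly_form_def ring_distribs sum.distrib)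

lemma poly_form_diff_right: "poly_form w (u - v) = poly_form w u - poly_form w v"
  by (simp only: poly_form_def right_diff_distrib sum_subtractf vector_minus_component)

lemma poly_form_scale_right: "poly_form v (c *s w) = c * poly_form v w"
  by (simp add: poly_form_def sum_distrib_left mult_ac)

lemma map_poly_cnj_sum: "map_poly cnj (\<Sum>a\<in>A. f a) = (\<Sum>a\<in>A. map_poly cnj (f a))"
  by (rule poly_eqI) (simp add: coeff_map_poly coeff_sum)

lemma map_poly_cnj_cnj [simp]: "map_poly cnj (map_poly cnj p) = p"
  by (rule poly_eqI) (simp add: coeff_map_poly)

lemma map_poly_cnj_const [simp]: "map_poly cnj [:c:] = [:cnj c:]"
  by (rule poly_eqI) (simp add: coeff_map_poly coeff_pCons split: nat.split)

lemma poly_form_cnj: "map_poly cnj (poly_form v w) = poly_form w v"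
  unfolding poly_form_def map_poly_cnj_sum map_poly_cnj_mult map_poly_cnj_const map_poly_cnj_cnj
    cnj_pq_sign
  by (rule sum.cong) (simp_all only: mult_ac)

lemma poly_form_add_left: "poly_form (u + v) w = poly_form u w + poly_form v w"
  by (subst (1 2 3) poly_form_cnj[symmetric]) (simp add: poly_form_add_right map_poly_cnj_add)

lemma poly_form_diff_left: "poly_form (u - v) w = poly_form u w - poly_form v w"
  by (subst (1 2 3) poly_form_cnj[symmetric]) (simp add: poly_form_diff_right map_poly_cnj_diff)

lemma poly_form_scale_left: "poly_form (c *s v) w = map_poly cnj c * poly_form v w"
  by (subst (1 2) poly_form_cnj[symmetric]) (simp add: poly_form_scale_right map_poly_cnj_mult)

lemmas poly_form_linear = poly_form_add_left poly_form_add_right poly_form_diff_left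
  poly_form_diff_right poly_form_scale_left poly_form_scale_right

lemma coeff_poly_form:
  "coeff (poly_form x y) m = (\<Sum>i\<le>m. pq_form (coeff_vec x i) (coeff_vec y (m - i)))"
proof -
  have "coeff (poly_form x y) m =
    (\<Sum>a\<in>UNIV. pq_sign a * (\<Sum>i\<le>m. cnj (coeff (x $ a) i) * coeff (y $ a) (m - i)))"
    by (simp add: poly_form_def coeff_sum coeff_mult coeff_map_poly)
  also have "\<dots> = (\<Sum>i\<le>m. \<Sum>a\<in>UNIV. pq_sign a * cnj (coeff (x $ a) i) * coeff (y $ a) (m - i))"
    by (subst sum.swap) (simp add: sum_distrib_left mult_ac)
  finally show ?thesis
    by (simp add: pq_form_altdef coeff_vec_def)
qed

lemma coeff_vec_add: "coeff_vec (x + y) k = coeff_vec x k + coeff_vec y k"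
  by (simp add: coeff_vec_def vec_eq_iff)

lemma coeff_vec_diff: "coeff_vec (x - y) k = coeff_vec x k - coeff_vec y k"
  by (simp add: coeff_vec_def vec_eq_iff)

lemma coeff_vec_const: "coeff_vec (const_vec v) k = (if k = 0 then v else 0)"
  by (simp add: coeff_vec_def const_vec_def vec_eq_iff coeff_pCons split: nat.split)

lemma coeff_vec_scale_const: "coeff_vec (p *s const_vec v) k = coeff p k *s v"
  by (simp add: coeff_vec_def const_vec_def vec_eq_iff mult.commute)

lemma vec_eq_iff_coeff_vec: "x = y \<longleftrightarrow> (\<forall>k. coeff_vec x k = coeff_vec y k)"
  by (auto simp: coeff_vec_def vec_eq_iff poly_eq_iff)

lemma coeff_poly_form_const: "coeff (poly_form (const_vec v) x) k = pq_form v (coeff_vec x k)"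
  by (simp add: poly_form_def coeff_sum coeff_vec_def const_vec_def map_poly_cnj_const pq_form_altdef mult_ac)

lemma poly_form_const: "poly_form (const_vec v) (const_vec w) = [:pq_form v w:]"
  by (rule poly_eqI) (simp add: coeff_poly_form_const coeff_vec_const coeff_pCons split: nat.split)

lemma const_vec_add: "const_vec (v + w) = const_vec v + const_vec w"
  by (simp add: const_vec_def vec_eq_iff)

lemma const_vec_diff: "const_vec (v - w) = const_vec v - const_vec w"
  by (simp add: const_vec_def vec_eq_iff)

lemma const_vec_scale: "const_vec (c *s v) = [:c:] *s const_vec v"
  by (simp add: const_vec_def vec_eq_iff)

section \<open>Elementary polynomial isometries\<close>

text \<open>The rank one endomorphism \<open>x \<mapsto> \<langle>w, x\<rangle> v\<close>. Sign and
  conjugate are placed so that \<open>adj\<close> merely exchanges the two arguments.\<close>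

definition outer :: "complex ^ ('p::finite + 'q::finite) \<Rightarrow> complex ^ ('p + 'q) \<Rightarrow>
    complex ^ ('p + 'q) ^ ('p + 'q)" where
  "outer v w = (\<chi> a b. v $ a * (pq_sign b * cnj (w $ b)))"

lemma outer_mult: "outer v w *v x = pq_form w x *s v"
  by (simp add: vec_eq_iff matrix_vector_mult_def outer_def pq_form_altdef sum_distrib_left
      sum_distrib_right mult_ac)

definition monom_mat :: "nat \<Rightarrow> complex ^ 'n ^ 'm \<Rightarrow> complex poly ^ 'n ^ 'm" where
  "monom_mat k A = map_matrix (\<lambda>c. monom c k) A"

lemma monom_mat_diff: "monom_mat k (A - B) = monom_mat k A - monom_mat k B"
  by (simp add: monom_mat_def vec_eq_iff diff_monom)

lemma monom_mat_outer_mult: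
  "monom_mat k (outer v w) *v x = (monom 1 k * poly_form (const_vec w) x) *s const_vec v"
proof -
  have *: "monom (a * (b * c)) k * p = monom 1 k * ([:b:] * [:c:] * p) * [:a:]"
    for a b c :: complex and p
    by (rule poly_eqI) (simp add: coeff_monom_mult)
  show ?thesis
    unfolding vec_eq_iff matrix_vector_mult_def monom_mat_def outer_def poly_form_def const_vec_def
    by (simp only: vec_lambda_beta nth_map_matrix vector_smult_component map_poly_cnj_const sum_distrib_left
      sum_distrib_right *) simp
qed

text \<open>The factor \<open>\<i>\<close> with real \<open>c\<close> makes the endomorphism
  skew-adjoint. For isotropic \<open>v\<close> its square vanishes, so this is its exponential after
  scaling by \<open>t^k\<close>.\<close>

definition m_elt :: "real \<Rightarrow> complex ^ ('p::finite + 'q::finite) \<Rightarrow> nat \<Rightarrow>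
    complex poly ^ ('p + 'q) ^ ('p + 'q)" where
  "m_elt c v k = mat 1 + monom_mat k (outer ((\<i> * of_real c) *s v) v)"

text \<open>For isotropic \<open>v\<close> and \<open>w\<close> orthogonal to \<open>v\<close>, the
  skew-adjoint \<open>N = outer v w - outer w v\<close> satisfies
  \<open>N ** N = outer (- pq_form w w *s v) v\<close>. The last term is thus half the square, and
  the whole is the exponential of \<open>t^k N\<close>.\<close>

definition n_elt :: "complex ^ ('p::finite + 'q::finite) \<Rightarrow> complex ^ ('p + 'q) \<Rightarrow> nat \<Rightarrow>
    complex poly ^ ('p + 'q) ^ ('p + 'q)" where
  "n_elt v w k = mat 1 + monom_mat k (outer v w - outer w v)
     + monom_mat (2 * k) (outer ((- pq_form w w / 2) *s v) v)"

lemma m_elt_mult: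
  "m_elt c v k *v x = x + (monom (\<i> * of_real c) k * poly_form (const_vec v) x) *s const_vec v"
proof -
  have "monom (\<i> * of_real c) k = [:\<i> * of_real c:] * monom 1 k"
    by (simp add: smult_monom)
  then show ?thesis
    by (simp add: m_elt_def matrix_vector_mult_add_rdistrib monom_mat_outer_mult const_vec_scale
        mult_ac)
qed

lemma n_elt_mult:
  "n_elt v w k *v x = x + (monom 1 k * poly_form (const_vec w) x) *s const_vec v
     - (monom 1 k * poly_form (const_vec v) x) *s const_vec w
     - (monom (pq_form w w / 2) (2 * k) * poly_form (const_vec v) x) *s const_vec v"
proof -
  have "monom 1 (2 * k) * p * [:- (pq_form w w / 2) * z:] = - (monom (pq_form w w / 2) (2 * k) * p * [:z:])"
    for p z
    by (rule poly_eqI) (simp add: coeff_monom_mult)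
  then show ?thesis
    by (simp add: n_elt_def matrix_vector_mult_add_rdistrib matrix_vector_mult_diff_rdistrib
      monom_mat_diff monom_mat_outer_mult vec_eq_iff const_vec_def del: mult_pCons_right)
qed

lemma m_elt_form:
  assumes "pq_form v v = 0"
  shows "poly_form (m_elt c v k *v x) (m_elt c v k *v y) = poly_form x y"
proof -
  have *: "poly_form x (const_vec v) = map_poly cnj (poly_form (const_vec v) x)" for x
    by (simp add: poly_form_cnj)
  show ?thesis
    unfolding m_elt_mult poly_form_linear poly_form_const assms map_poly_cnj_mult map_poly_cnj_monom *[of x]
    by (simp add: minus_monom[symmetric] algebra_simps)
qed

text \<open>The terms of degree \<open>k\<close> cancel in pairs by skew-adjointness. The product of
  the two \<open>w\<close> terms contributes \<open>\<langle>w, w\<rangle>\<close> in degree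
  \<open>2 * k\<close>, which the two halves carried by the last term of \<open>n_elt\<close>
  compensate.\<close>

lemma n_elt_form:
  assumes "pq_form v v = 0" "pq_form v w = 0"
  shows "poly_form (n_elt v w k *v x) (n_elt v w k *v y) = poly_form x y"
proof -
  have *: "poly_form x (const_vec v) = map_poly cnj (poly_form (const_vec v) x)" for x and v :: "complex ^ ('a + 'b)"
    by (simp add: poly_form_cnj)
  have c: "cnj (pq_form w w / 2) = pq_form w w / 2"
    by (simp add: pq_form_cnj)
  have m: "monom 1 k * monom 1 k * [:pq_form w w:] = 2 * monom (pq_form w w / 2) (2 * k)"
    by (simp add: mult_monom mult_2 smult_monom mult.commute[of _ "[:_:]"] add_monom)
  have w: "pq_form w v = 0" using assms(2) by (rule pq_form_eq_0_sym)
  define a where "a = poly_form (const_vec v) x"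
  define b where "b = poly_form (const_vec w) x"
  define a' where "a' = poly_form (const_vec v) y"
  define b' where "b' = poly_form (const_vec w) y"
  define M where "M = monom (pq_form w w / 2) (2 * k)"
  define N where "N = monom (1::complex) k"
  define W where "W = [:pq_form w w:]"
  have cN: "map_poly cnj N = N" and cM: "map_poly cnj M = M"
    unfolding N_def M_def map_poly_cnj_monom c by simp_all
  have M: "N * N * W = 2 * M" unfolding M_def N_def W_def by (rule m)
  have M': "N * (N * (W * z)) = M * (z * 2)" for z
    using arg_cong[OF M, of "\<lambda>y. y * z"] by (simp add: mult_ac)
  show ?thesis
    unfolding n_elt_mult poly_form_linear poly_form_const assms w map_poly_cnj_mult
      * [of x v] * [of x w] a_def[symmetric] b_def[symmetric] a'_def[symmetric] b'_def[symmetric] 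
      M_def[symmetric] N_def[symmetric] W_def[symmetric] cN cM
  by (simp add: algebra_simps M')
qed

lemma monom_square_const: "monom 1 k * (monom 1 k * [:c:]) = monom (c::complex) (2 * k)"
  by (simp add: mult_monom smult_monom mult_2)

lemma m_elt_inverse:
  assumes "pq_form v v = 0"
  shows "m_elt (- c) v k ** m_elt c v k = mat 1"
proof -
  have "m_elt (- c) v k *v (m_elt c v k *v x) = x" for x
    by (simp add: m_elt_mult poly_form_linear poly_form_const assms vec_eq_iff
        flip: minus_monom)
  then show ?thesis
    by (simp add: matrix_eq matrix_vector_mul_assoc)
qed

lemma n_elt_inverse:
  assumes "pq_form v v = 0" "pq_form v w = 0"
  shows "n_elt v (- w) k ** n_elt v w k = mat 1"
proof -
  have w: "pq_form w v = 0" using assms(2) by (rule pq_form_eq_0_sym)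
  define N where "N = monom (1::complex) k"
  define M where "M = monom (pq_form w w / 2) (2 * k)"
  have M0: "N * (N * [:pq_form w w:]) = M + M"
    by (simp only: N_def M_def monom_square_const add_monom) simp
  from M0 have M: "N * (N * ([:pq_form w w:] * p)) = M * p + M * p" for p
    by (simp only: mult.assoc[symmetric] distrib_right[symmetric])
  have neg: "const_vec (- w) = - const_vec w" "poly_form (- x) y = - poly_form x y" for x y :: "complex poly ^ ('a + 'b)"
    using const_vec_diff[of 0 w] poly_form_diff_left[of 0 x y]  
    by (simp_all add: const_vec_def vec_eq_iff poly_form_def)
  have "n_elt v (- w) k *v (n_elt v w k *v x) = x" for x
    unfolding n_elt_mult poly_form_linear poly_form_const assms w neg pq_form_minus N_def[symmetric] minus_minus
      M_def[symmetric] 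
    by (simp add: vec_eq_iff algebra_simps M M0 del: mult_pCons_left mult_pCons_right minus_pCons diff_pCons add_pCons)
  then show ?thesis
    by (simp add: matrix_eq matrix_vector_mul_assoc)
qed

text \<open>For fixed \<open>v\<close> the Siegel transformations behave like a Heisenberg group:
  they are additive in \<open>w\<close> up to a transvection along \<open>v\<close>, which measures
  the failure to commute. This permits splitting \<open>w\<close> into convenient summands.\<close>

lemma n_elt_add:
  assumes "pq_form v v = 0" "pq_form v w = 0" "pq_form v w' = 0"
  shows "n_elt v (w + w') k = m_elt (Im (pq_form w w')) v (2 * k) ** (n_elt v w k ** n_elt v w' k)"
proof -
  have w: "pq_form w v = 0" "pq_form w' v = 0" using assms(2,3) by (auto intro: pq_form_eq_0_sym)
  define N where "N = monom (1::complex) k"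
  define M where "M = monom (pq_form w w / 2) (2 * k)"
  define M' where "M' = monom (pq_form w' w' / 2) (2 * k)"
  define J where "J = monom (\<i> * of_real (Im (pq_form w w'))) (2 * k)"
  \<comment> \<open>The mixed terms on the left have half-sum
    \<open>Re \<langle>w, w'\<rangle>\<close>, whereas composing the two transformations produces
    the full \<open>\<langle>w, w'\<rangle>\<close>. The difference is the imaginary part.\<close>
  have "(pq_form w w + pq_form w' w + (pq_form w w' + pq_form w' w')) / 2
      = pq_form w w / 2 + pq_form w' w' / 2 + pq_form w w' - \<i> * of_real (Im (pq_form w w'))"
    using pq_form_cnj[of w w'] by (auto simp: complex_eq_iff)
  then have M: "monom ((pq_form w w + pq_form w' w + (pq_form w w' + pq_form w' w')) / 2) (2 * k)
     = M + M' - J + N * (N * [:pq_form w w':])"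
    by (simp only: M_def M'_def J_def N_def monom_square_const add_monom[symmetric] diff_monom[symmetric])
      simp
  have "n_elt v (w + w') k *v x = m_elt (Im (pq_form w w')) v (2 * k) *v (n_elt v w k *v (n_elt v w' k *v x))" for x
    unfolding n_elt_mult m_elt_mult poly_form_linear poly_form_const assms w pq_form_linear const_vec_add M
      N_def[symmetric] M_def[symmetric] M'_def[symmetric] J_def[symmetric]
    by (simp add: vec_eq_iff algebra_simps del: mult_pCons_left mult_pCons_right minus_pCons diff_pCons add_pCons)
  then show ?thesis
    by (simp add: matrix_eq matrix_vector_mul_assoc)
qed

text \<open>Now \<open>v\<close> and \<open>w\<close> span an isotropic space, so all products of
  the outer products involved vanish and exponents add. Polarization gives
  \<open>outer v w - outer w v\<close> as \<open>\<i>\<close> times the outer square of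
  \<open>v + \<i> *s w\<close> minus those of \<open>v\<close> and \<open>w\<close>.\<close>

lemma n_elt_isotropic:
  assumes "pq_form v v = 0" "pq_form v w = 0" "pq_form w w = 0"
  shows "n_elt v w k = m_elt 1 (v + \<i> *s w) k ** (m_elt (-1) v k ** m_elt (-1) w k)"
proof -
  have w: "pq_form w v = 0" using assms(2) by (rule pq_form_eq_0_sym)
  define N where "N = monom (1::complex) k"
  have i: "[:\<i>:] * ([:\<i>:] * p) = - p" "[:-\<i>:] = - [:\<i>:]" for p
    by (simp_all flip: mult.assoc)
  have m: "monom \<i> k = N * [:\<i>:]" "monom (-\<i>) k = - (N * [:\<i>:])"
    by (simp_all add: N_def smult_monom minus_monom)
  have "n_elt v w k *v x = m_elt 1 (v + \<i> *s w) k *v (m_elt (-1) v k *v (m_elt (-1) w k *v x))" for x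
    unfolding n_elt_mult m_elt_mult poly_form_linear poly_form_const assms w pq_form_linear const_vec_add
      const_vec_scale N_def[symmetric] map_poly_cnj_const complex_cnj_i of_real_1 of_real_minus mult_1_right
      mult_minus_right m i(2)
    by (simp add: vec_eq_iff algebra_simps i del: mult_pCons_left mult_pCons_right minus_pCons diff_pCons add_pCons)
  then show ?thesis
    by (simp add: matrix_eq matrix_vector_mul_assoc)
qed

text \<open>The degenerate Siegel transformation: its exponent is \<open>cnj b - b\<close> times
  \<open>outer v v\<close>. It serves to change \<open>w\<close> by multiples of
  \<open>v\<close>.\<close>

lemma n_elt_self:
  assumes "pq_form v v = 0"
  shows "n_elt v (b *s v) k = m_elt (- 2 * Im b) v k"
proof -
  have c: "monom (\<i> * complex_of_real (- 2 * Im b)) k = monom 1 k * ([:cnj b:] - [:b:])"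
    by (rule poly_eqI) (auto simp: coeff_monom_mult complex_eq_iff smult_monom)
  have "n_elt v (b *s v) k *v x = m_elt (- 2 * Im b) v k *v x" for x
    unfolding n_elt_mult m_elt_mult poly_form_linear pq_form_linear const_vec_scale map_poly_cnj_const c assms
    by (simp add: vec_eq_iff algebra_simps del: mult_pCons_left mult_pCons_right minus_pCons diff_pCons add_pCons)
  then show ?thesis
    by (simp add: matrix_eq)
qed

section \<open>The group generated by elementary isometries\<close>

text \<open>Restricting the vectors to \<open>Z\<close> confines a product to the complement of the
  planes already straightened. The condition \<open>k \<ge> 1\<close> keeps the value at
  \<open>t = 0\<close> equal to the identity. Only left multiplication by generators is built in;
  closure under products, and inverses for \<open>Z = UNIV\<close>, are derived.\<close>

inductive_set elem_group ::
  "(complex ^ ('p::finite + 'q::finite)) set \<Rightarrow> (complex poly ^ ('p + 'q) ^ ('p + 'q)) set"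
  for Z where
  one: "mat 1 \<in> elem_group Z"
| m: "v \<in> Z \<Longrightarrow> pq_form v v = 0 \<Longrightarrow> k \<ge> 1 \<Longrightarrow> u \<in> elem_group Z \<Longrightarrow> m_elt c v k ** u \<in> elem_group Z"
| n: "v \<in> Z \<Longrightarrow> w \<in> Z \<Longrightarrow> pq_form v v = 0 \<Longrightarrow> pq_form v w = 0 \<Longrightarrow> k \<ge> 1 \<Longrightarrow> u \<in> elem_group Z \<Longrightarrow>
    n_elt v w k ** u \<in> elem_group Z"

lemma elem_group_m: "v \<in> Z \<Longrightarrow> pq_form v v = 0 \<Longrightarrow> k \<ge> 1 \<Longrightarrow> m_elt c v k \<in> elem_group Z"
  using elem_group.m[OF _ _ _ elem_group.one] by auto

lemma elem_group_n:
  "v \<in> Z \<Longrightarrow> w \<in> Z \<Longrightarrow> pq_form v v = 0 \<Longrightarrow> pq_form v w = 0 \<Longrightarrow> k \<ge> 1 \<Longrightarrow> n_elt v w k \<in> elem_group Z"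
  using elem_group.n[OF _ _ _ _ _ elem_group.one] by auto

lemma elem_group_mult:
  assumes "u \<in> elem_group Z" "u' \<in> elem_group Z"
  shows "u ** u' \<in> elem_group Z"
  using assms
  by (induction rule: elem_group.induct) (auto simp: matrix_mul_assoc[symmetric] intro: elem_group.intros)

lemma elem_group_mono: "u \<in> elem_group Z \<Longrightarrow> Z \<subseteq> Z' \<Longrightarrow> u \<in> elem_group Z'"
  by (induction rule: elem_group.induct) (auto intro: elem_group.intros)

lemma elem_group_left_inverse:
  assumes "u \<in> elem_group UNIV"
  obtains u' where "u' \<in> elem_group UNIV" "u' ** u = mat 1"
proof -
  have "\<exists>u'\<in>elem_group UNIV. u' ** u = mat 1"
    using assms
  proof induction
    case one
    show ?case by (auto intro!: bexI[of _ "mat 1"] elem_group.one)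
  next
    case (m v k u c)
    then obtain u' where u': "u' \<in> elem_group UNIV" "u' ** u = mat 1" by auto
    have "(u' ** m_elt (- c) v k) ** (m_elt c v k ** u) = u' ** (m_elt (- c) v k ** m_elt c v k) ** u"
      by (simp only: matrix_mul_assoc)
    also have "\<dots> = mat 1" using m u' by (simp add: m_elt_inverse)
    finally show ?case
      using m u' by (intro bexI[of _ "u' ** m_elt (- c) v k"] elem_group_mult elem_group_m) auto
  next
    case (n v w k u)
    then obtain u' where u': "u' \<in> elem_group UNIV" "u' ** u = mat 1" by auto
    have "(u' ** n_elt v (- w) k) ** (n_elt v w k ** u) = u' ** (n_elt v (- w) k ** n_elt v w k) ** u"
      by (simp only: matrix_mul_assoc)
    also have "\<dots> = mat 1" using n u' by (simp add: n_elt_inverse)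
    finally show ?case
      using n u' by (intro bexI[of _ "u' ** n_elt v (- w) k"] elem_group_mult elem_group_n)
        (auto simp: pq_form_minus)
  qed
  then show ?thesis using that by blast
qed

lemma elem_group_form:
  "u \<in> elem_group Z \<Longrightarrow> poly_form (u *v x) (u *v y) = poly_form x y"
  by (induction arbitrary: x y rule: elem_group.induct)
    (auto simp: m_elt_form n_elt_form simp flip: matrix_vector_mul_assoc)

lemma coeff_vec_scale_monom:
  "coeff_vec ((monom c k * p) *s const_vec v) i = (if i < k then 0 else (c * coeff p (i - k)) *s v)"
  by (simp add: coeff_vec_scale_const coeff_monom_mult)

lemma coeff_vec_m_elt:
  "coeff_vec (m_elt c v k *v x) i = coeff_vec x i +
     (if i < k then 0 else (\<i> * of_real c * pq_form v (coeff_vec x (i - k))) *s v)"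
  by (simp add: m_elt_mult coeff_vec_add coeff_vec_scale_monom coeff_poly_form_const)

lemma coeff_vec_n_elt:
  "coeff_vec (n_elt v w k *v x) i = coeff_vec x i +
     (if i < k then 0 else pq_form w (coeff_vec x (i - k)) *s v - pq_form v (coeff_vec x (i - k)) *s w) -
     (if i < 2 * k then 0 else (pq_form w w / 2 * pq_form v (coeff_vec x (i - 2 * k))) *s v)"
  by (simp add: n_elt_mult coeff_vec_add coeff_vec_diff coeff_vec_scale_monom coeff_poly_form_const)

lemma elem_group_coeff_0:
  "u \<in> elem_group Z \<Longrightarrow> coeff_vec (u *v x) 0 = coeff_vec x 0"
  by (induction arbitrary: x rule: elem_group.induct)
    (auto simp: coeff_vec_m_elt coeff_vec_n_elt simp flip: matrix_vector_mul_assoc)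

lemma m_elt_fix: "pq_form v h = 0 \<Longrightarrow> m_elt c v k *v const_vec h = const_vec h"
  by (simp add: m_elt_mult poly_form_const)

lemma n_elt_fix: "pq_form v h = 0 \<Longrightarrow> pq_form w h = 0 \<Longrightarrow> n_elt v w k *v const_vec h = const_vec h"
  by (simp add: n_elt_mult poly_form_const)

lemma elem_group_fix:
  "u \<in> elem_group Z \<Longrightarrow> (\<And>v. v \<in> Z \<Longrightarrow> pq_form v h = 0) \<Longrightarrow> u *v const_vec h = const_vec h"
  by (induction rule: elem_group.induct)
    (auto simp: m_elt_fix n_elt_fix simp flip: matrix_vector_mul_assoc)

section \<open>Reduction of isotropic polynomial vectors\<close>

text \<open>The standard basis is orthogonal, so this is the orthogonal complement of the basis
  vectors indexed by \<open>A\<close>, and the form stays nondegenerate on it.\<close>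

definition coord_space :: "'n set \<Rightarrow> (complex ^ 'n) set" where
  "coord_space A = {x. \<forall>a\<in>A. x $ a = 0}"

lemma elem_group_coord_space:
  "u \<in> elem_group (coord_space A) \<Longrightarrow> (\<And>i. coeff_vec x i \<in> coord_space A) \<Longrightarrow>
     coeff_vec (u *v x) i \<in> coord_space A"
  by (induction arbitrary: x i rule: elem_group.induct)
    (auto simp: coord_space_def coeff_vec_m_elt coeff_vec_n_elt simp flip: matrix_vector_mul_assoc)

text \<open>Nondegeneracy on \<open>coord_space A\<close>: some pair of coordinates shows that
  \<open>v\<close> and \<open>x\<close> are independent, and \<open>w\<close> can be supported
  there. The value \<open>- 1\<close> is what later cancels a leading coefficient
  \<open>v\<close>.\<close>

lemma separating_vector:
  assumes "v \<in> coord_space A" "x \<in> coord_space A" "v \<noteq> 0" "\<nexists>c. x = c *s v"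
  obtains w where "w \<in> coord_space A" "pq_form w v = 0" "pq_form w x = - 1"
proof -
  obtain a where a: "v $ a \<noteq> 0" using assms(3) by (auto simp: vec_eq_iff)
  obtain b where b: "x $ b \<noteq> x $ a / v $ a * v $ b"
    using assms(4)[simplified, rule_format, of "x $ a / v $ a"] unfolding vec_eq_iff by auto
  have ab: "a \<notin> A" "b \<notin> A" using a b assms(1,2) by (auto simp: coord_space_def)
  \<comment> \<open>The two-by-two minor of \<open>v\<close> and \<open>x\<close> at the coordinates
    \<open>a\<close> and \<open>b\<close>; \<open>w\<close> solves the resulting linear system by
    Cramer's rule.\<close>
  define D where "D = x $ a * v $ b - x $ b * v $ a"
  have D: "D \<noteq> 0" using a b by (auto simp: D_def field_simps)
  define w where "w = axis b (pq_sign b * cnj (v $ a / D)) - axis a (pq_sign a * cnj (v $ b / D))"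
  have form: "pq_form w y = v $ a / D * y $ b - v $ b / D * y $ a" for y
    by (simp add: w_def pq_form_linear pq_form_axis mult.assoc[symmetric])
  show ?thesis
  proof
    show "w \<in> coord_space A"
      using ab by (auto simp: coord_space_def w_def axis_def)
    show "pq_form w v = 0" by (simp add: form)
    have "pq_form w x = (v $ a * x $ b - v $ b * x $ a) / D"
      by (simp add: form diff_divide_distrib)
    also have "\<dots> = - 1" using D by (simp add: D_def field_simps)
    finally show "pq_form w x = - 1" .
  qed
qed

text \<open>The transvection of degree \<open>r - d\<close> lifts the leading coefficient
  \<open>q\<close> of \<open>\<langle>v, y\<rangle>\<close> to degree \<open>r\<close>, where it
  adds \<open>\<i> c q v\<close>. A real \<open>c\<close> with \<open>e + \<i> c q = 0\<close>
  exists exactly because \<open>e * cnj q\<close> is purely imaginary.\<close>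

lemma m_elt_cancels_top:
  assumes v: "pq_form v v = 0"
    and top: "coeff_vec y r = e *s v" "\<And>i. i > r \<Longrightarrow> coeff_vec y i = 0"
    and d: "d < r" "\<And>i. i > d \<Longrightarrow> pq_form v (coeff_vec y i) = 0"
    and q: "pq_form v (coeff_vec y d) \<noteq> 0" "Re (e * cnj (pq_form v (coeff_vec y d))) = 0"
  obtains c where "\<And>i. i \<ge> r \<Longrightarrow> coeff_vec (m_elt c v (r - d) *v y) i = 0"
proof
  define q where "q = pq_form v (coeff_vec y d)"
  define t where "t = Im (e * cnj q)"
  define c where "c = - t / (cmod q)\<^sup>2"
  have qq: "q * cnj q = of_real ((cmod q)\<^sup>2)" by (rule complex_norm_square[symmetric])
  have q0: "q \<noteq> 0" using q by (simp add: q_def)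
  have "e * cnj q = \<i> * of_real t"
    using q(2) by (simp add: complex_eq_iff q_def t_def)
  moreover have "of_real c * (q * cnj q) = - of_real t"
    unfolding qq c_def using q0 by simp
  moreover have "(e + \<i> * of_real c * q) * cnj q = e * cnj q + \<i> * (of_real c * (q * cnj q))"
    by (simp add: algebra_simps)
  ultimately have "(e + \<i> * of_real c * q) * cnj q = 0"
    by simp
  then have c: "e + \<i> * of_real c * q = 0" using q0 by simp
  fix i assume "i \<ge> r"
  then consider "i = r" | "i > r" by linarith
  then show "coeff_vec (m_elt c v (r - d) *v y) i = 0"
  proof cases
    case 1
    then show ?thesis using d(1) top(1) c
      by (simp add: coeff_vec_m_elt q_def flip: vec.scale_left_distrib)
  next
    case 2
    then show ?thesis using d top(2) by (simp add: coeff_vec_m_elt)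
  qed
qed

text \<open>One step of the Euclidean algorithm. Isotropy restricts the top coefficients by
  comparing degrees in \<open>\<langle>x, x\<rangle>\<close>, while the pairing with
  \<open>y\<close> excludes that \<open>x\<close> is a nonconstant polynomial times a constant
  vector.\<close>

lemma lower_degree:
  assumes Z: "\<And>i. coeff_vec x i \<in> coord_space A"
    and iso: "poly_form x x = 0" and unimod: "poly_form y x = 1"
    and r: "r \<ge> 1" "coeff_vec x r \<noteq> 0" "\<And>i. i > r \<Longrightarrow> coeff_vec x i = 0"
  obtains u where "u \<in> elem_group (coord_space A)" "\<And>i. i \<ge> r \<Longrightarrow> coeff_vec (u *v x) i = 0"
proof -
  define X where "X = coeff_vec x"
  define v where "v = X r"
  define q where "q i = pq_form v (X i)" for i
  define s where "s = Max {i. \<nexists>c. X i = c *s v}"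
  \<comment> \<open>With \<open>d\<close> the degree of \<open>\<langle>v, x\<rangle>\<close>: a Siegel transformation along \<open>t\<^sup>k v\<close> keeps the degree of \<open>x\<close>
    at most \<open>r\<close> if \<open>k \<le> r - s\<close> and \<open>2 k \<le> r - d\<close>. If \<open>2 s > r + d\<close>, then \<open>k = r - s\<close> is extremal and
    the term \<open>\<langle>w, X s\<rangle> v\<close> alone cancels \<open>v\<close>. Otherwise a transvection with \<open>k = r - d\<close> cancels \<open>v\<close>,
    after the contribution of \<open>X s\<close> to \<open>\<langle>x, x\<rangle>\<close> in degree \<open>r + d\<close> is removed if \<open>2 s = r + d\<close>.\<close>
  have v0: "v \<noteq> 0" and vZ: "v \<in> coord_space A" using r Z by (auto simp: v_def X_def)
  have sum0: "(\<Sum>i\<le>m. pq_form (X i) (X (m - i))) = 0" for m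
    using coeff_poly_form[of x x m] iso by (simp add: X_def)
  have "(\<Sum>i\<le>r + r. pq_form (X i) (X (r + r - i))) = (\<Sum>i\<in>{r}. pq_form (X i) (X (r + r - i)))"
  proof (rule sum.mono_neutral_right)
    show "\<forall>i\<in>{..r + r} - {r}. pq_form (X i) (X (r + r - i)) = 0"
    proof
      fix i assume "i \<in> {..r + r} - {r}"
      then have "i > r \<or> r + r - i > r" by auto
      then show "pq_form (X i) (X (r + r - i)) = 0" using r(3) by (auto simp: X_def)
    qed
  qed auto
  then have vv: "pq_form v v = 0" using sum0[of "r + r"] by (simp add: v_def)

  \<comment> \<open>Otherwise \<open>x\<close> is \<open>f\<close> times the constant vector
    \<open>v\<close>; then \<open>f\<close> divides \<open>1\<close>, so it is constant, contrary to
    \<open>r \<ge> 1\<close>.\<close>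
  have ex: "\<exists>i. \<nexists>c. X i = c *s v"
  proof (rule ccontr)
    assume "\<not> ?thesis"
    then obtain c where c: "X i = c i *s v" for i by metis
    obtain a where a: "v $ a \<noteq> 0" using v0 by (auto simp: vec_eq_iff)
    define f where "f = smult (1 / v $ a) (x $ a)"
    have f: "coeff f i = c i" for i
      using c[of i] a by (simp add: f_def X_def coeff_vec_def vec_eq_iff)
    have "x = f *s const_vec v"
      unfolding vec_eq_iff_coeff_vec coeff_vec_scale_const f using c by (simp add: X_def)
    then have "f * poly_form y (const_vec v) = 1"
      using unimod by (metis poly_form_scale_right)
    then have "degree f = 0"
      by (metis dvd_triv_left is_unit_iff_degree one_neq_zero mult_zero_left)
    then have "c r = 0" using r(1) f[of r] by (simp add: coeff_eq_0)
    then show False using c[of r] v0 by (simp add: v_def)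
  qed
  have le: "i \<le> r" if "\<nexists>c. X i = c *s v" for i
    using that r(3) by (metis X_def not_le vec.scale_zero_left)
  then have "{i. \<nexists>c. X i = c *s v} \<subseteq> {..r}" by blast
  then have fin: "finite {i. \<nexists>c. X i = c *s v}" by (rule finite_subset) simp
  have s: "\<nexists>c. X s = c *s v"
    using Max_in[OF fin] ex unfolding s_def by auto
  have above_s: "\<exists>c. X i = c *s v" if "i > s" for i
    using Max_ge[OF fin] that unfolding s_def by fastforce
  have "X r = 1 *s v" by (simp add: v_def)
  then have sr: "s < r" using s le[OF s] by (metis nat_less_le)
  have q_above_s: "q i = 0" if "i > s" for i
    using above_s[OF that] by (auto simp: q_def pq_form_linear vv)
  have Xs_left: "pq_form (X i) (X l) = 0" if "i > s" "q l = 0" for i l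
    using above_s[OF that(1)] that(2) by (auto simp: q_def pq_form_linear)
  have Xs_right: "pq_form (X i) (X l) = 0" if "l > s" "q i = 0" for i l
    using Xs_left[OF that] by (rule pq_form_eq_0_sym)
  have w_above_s: "pq_form w (X i) = 0" if "i > s" "pq_form w v = 0" for i w
    using above_s[OF that(1)] that(2) by (auto simp: pq_form_linear)

  show ?thesis
  proof (cases "\<exists>i. q i \<noteq> 0 \<and> 2 * s \<le> r + i")
    case True
    have "{i. q i \<noteq> 0} \<subseteq> {..s}" using q_above_s by (auto simp flip: not_less)
    then have fin': "finite {i. q i \<noteq> 0}" by (rule finite_subset) simp
    define d where "d = Max {i. q i \<noteq> 0}"
    have d: "q d \<noteq> 0" using Max_in[OF fin'] True unfolding d_def by auto
    have above_d: "q i = 0" if "i > d" for i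
      using Max_ge[OF fin'] that unfolding d_def by fastforce
    have sd: "2 * s \<le> r + d" using True above_d by (meson le_trans not_le nat_add_left_cancel_le)
    have ds: "d \<le> s" using q_above_s d by (meson not_le)
    have dr: "d < r" using ds sr by simp
    \<comment> \<open>In degree \<open>r + d\<close> the pairs \<open>(r, d)\<close> and
      \<open>(d, r)\<close> always survive; the diagonal pair \<open>(s, s)\<close> has this degree
      only if \<open>2 * s = r + d\<close>.\<close>
    define T where "T = (if 2 * s = r + d then {s} else {})"
    have "(\<Sum>i\<le>r + d. pq_form (X i) (X (r + d - i))) =
       (\<Sum>i\<in>{r, d} \<union> T. pq_form (X i) (X (r + d - i)))"
    proof (rule sum.mono_neutral_right)
      show "\<forall>i\<in>{..r + d} - ({r, d} \<union> T). pq_form (X i) (X (r + d - i)) = 0"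
      proof
        \<comment> \<open>Either an index exceeds \<open>r\<close>, or one index exceeds
          \<open>s\<close>, so its coefficient is a multiple of \<open>v\<close>, and the other
          exceeds \<open>d\<close>, so its coefficient is orthogonal to \<open>v\<close>.\<close>
        fix i assume "i \<in> {..r + d} - ({r, d} \<union> T)"
        then have i: "i \<le> r + d" "i \<noteq> r" "i \<noteq> d" "2 * s = r + d \<Longrightarrow> i \<noteq> s"
          by (auto simp: T_def split: if_splits)
        then consider "i > r" | "r + d - i > r" | "i > s" "r + d - i > d" | "r + d - i > s" "i > d"
          using sd by linarith
        then show "pq_form (X i) (X (r + d - i)) = 0"
          by cases (use r(3) above_d Xs_left Xs_right in \<open>auto simp: X_def\<close>)
      qed
      show "{r, d} \<union> T \<subseteq> {..r + d}" using sr ds by (auto simp: T_def)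
    qed auto
    moreover have "T \<inter> {r, d} = {}" using sr dr by (auto simp: T_def)
    moreover have "pq_form (X d) v = cnj (q d)" by (simp add: q_def pq_form_cnj)
    ultimately have sum: "q d + cnj (q d) + (\<Sum>i\<in>T. pq_form (X i) (X (r + d - i))) = 0"
      using sum0[of "r + d"] dr by (subst (asm) sum.union_disjoint) (auto simp: T_def q_def v_def)
    show ?thesis
    proof (cases "2 * s = r + d")
      case False
      then have "Re (q d) = 0" using sum by (simp add: T_def complex_eq_iff)
      then obtain c where "\<And>i. i \<ge> r \<Longrightarrow> coeff_vec (m_elt c v (r - d) *v x) i = 0"
        using vv dr d r(3) above_d
        by (rule_tac m_elt_cancels_top[of v x r 1 d]) (auto simp: q_def v_def X_def)
      moreover have "m_elt c v (r - d) \<in> elem_group (coord_space A)"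
        using vv vZ dr by (intro elem_group_m) auto
      ultimately show ?thesis using that by blast
    next
      case True
      define S where "S = pq_form (X s) (X s)"
      have rds: "r + d - s = s" using True by simp
      have S: "q d + cnj (q d) + S = 0" using sum True rds by (simp add: T_def S_def)
      \<comment> \<open>With \<open>j = r - s\<close> one has \<open>s - j = d\<close>, so the term
        \<open>- q d *s w\<close> of the Siegel transformation cancels \<open>X s\<close> up to a
        multiple of \<open>v\<close>. The number \<open>e\<close> below is the resulting factor of
        \<open>v\<close> in degree \<open>r\<close>.\<close>
      define w where "w = (1 / q d) *s X s"
      define j where "j = r - s"
      define e where "e = 1 + S / cnj (q d) - S / 2 / cnj (q d)"
      have qs: "q s = 0" using above_d True dr by simp
      have j: "j \<ge> 1" "r - j = s" "r - 2 * j = d" "j \<le> r" "2 * j \<le> r"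
        using sr True by (auto simp: j_def)
      have vw: "pq_form v w = 0" using qs by (simp add: w_def pq_form_linear q_def)
      then have wv: "pq_form w v = 0" by (rule pq_form_eq_0_sym)
      have wZ: "w \<in> coord_space A" using Z by (auto simp: w_def coord_space_def X_def)
      have ww: "pq_form w w / 2 * q d = S / 2 / cnj (q d)" "pq_form w (X s) = S / cnj (q d)"
        using d by (simp_all add: w_def pq_form_linear S_def)
      define x' where "x' = n_elt v w j *v x"
      have n: "n_elt v w j \<in> elem_group (coord_space A)"
        using vv vw vZ wZ j by (intro elem_group_n) auto
      have q': "pq_form v (coeff_vec x' i) = q i" for i
        by (simp add: x'_def coeff_vec_n_elt pq_form_linear vv vw q_def X_def)
      have "coeff_vec x' r = e *s v"
        using j(2-5) qs ww by (simp add: x'_def coeff_vec_n_elt X_def[symmetric] q_def[symmetric] e_def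
          vec_eq_iff algebra_simps v_def[symmetric])
      moreover have "coeff_vec x' i = 0" if "i > r" for i
      proof -
        have "i - j > s" "i - 2 * j > d" "i \<ge> 2 * j" using that j by linarith+
        then show ?thesis
          using that w_above_s[of "i - j" w] wv above_d[of "i - 2 * j"] q_above_s[of "i - j"] r(3)[of i]
          by (simp add: x'_def coeff_vec_n_elt X_def[symmetric] q_def[symmetric])
      qed
      moreover have "Re (e * cnj (q d)) = 0"
      proof -
        have "e * cnj (q d) = cnj (q d) + S - S / 2"
          using d by (simp add: e_def algebra_simps)
        then show ?thesis using S by (simp add: complex_eq_iff)
      qed
      ultimately obtain c where c: "\<And>i. i \<ge> r \<Longrightarrow> coeff_vec (m_elt c v (r - d) *v x') i = 0"
        using vv dr d above_d by (rule_tac m_elt_cancels_top[of v x' r e d]) (auto simp: q')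
      show ?thesis
      proof (rule that)
        show "m_elt c v (r - d) ** n_elt v w j \<in> elem_group (coord_space A)"
          using vv vZ dr n by (intro elem_group_mult elem_group_m) auto
        show "coeff_vec ((m_elt c v (r - d) ** n_elt v w j) *v x) i = 0" if "i \<ge> r" for i
          using c[OF that] by (simp add: x'_def matrix_vector_mul_assoc)
      qed
    qed
  next
    case False
    then have q0: "q i = 0" if "2 * s \<le> r + i" for i using that by auto
    obtain w where w: "w \<in> coord_space A" "pq_form w v = 0" "pq_form w (X s) = - 1"
      using separating_vector[OF vZ _ v0 s] Z by (auto simp: X_def)
    define j where "j = r - s"
    have j: "j \<ge> 1" "r - j = s" "j \<le> r" using sr by (auto simp: j_def)
    show ?thesis
    proof (rule that)
      show "n_elt v w j \<in> elem_group (coord_space A)"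
        using vv w vZ j by (intro elem_group_n) (auto intro: pq_form_eq_0_sym)
      fix i assume i: "i \<ge> r"
      \<comment> \<open>The indices are at least \<open>s\<close> and \<open>2 * s - r\<close>, so
        both lie in the range where \<open>q\<close> vanishes. Only
        \<open>\<langle>w, X s\<rangle> v = - v\<close> is left in degree \<open>r\<close>.\<close>
      have q1: "q (i - j) = 0" by (rule q0) (use i j sr in linarith)
      have q2: "q (i - 2 * j) = 0" if "i \<ge> 2 * j" by (rule q0) (use i j sr that in linarith)
      show "coeff_vec (n_elt v w j *v x) i = 0"
      proof (cases "i = r")
        case True
        then show ?thesis using q1 q2 j w
          by (simp add: coeff_vec_n_elt X_def[symmetric] q_def[symmetric] v_def[symmetric])
      next
        case False
        with i have "i > r" by simp
        moreover then have "pq_form w (X (i - j)) = 0" using w j by (intro w_above_s) auto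
        ultimately show ?thesis using q1 q2 r(3)[of i]
          by (simp add: coeff_vec_n_elt X_def[symmetric] q_def[symmetric])
      qed
    qed
  qed
qed

lemma coeff_vec_eventually_0:
  obtains r where "\<And>i. i > r \<Longrightarrow> coeff_vec x i = 0"
proof
  fix i assume i: "i > (MAX a. degree (x $ a))"
  have "degree (x $ a) < i" for a
    by (rule le_less_trans[OF Max_ge i]) auto
  then show "coeff_vec x i = 0" by (auto simp: coeff_vec_def vec_eq_iff coeff_eq_0)
qed

text \<open>Descent on a degree bound by \<open>lower_degree\<close>. Moving \<open>y\<close> along
  with \<open>x\<close> preserves the pairing, and the constant term never changes, so the descent
  can only end at \<open>coeff_vec x 0\<close>.\<close>

lemma elem_group_makes_constant:
  assumes "\<And>i. coeff_vec x i \<in> coord_space A" "poly_form x x = 0" "poly_form y x = 1"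
  shows "\<exists>u\<in>elem_group (coord_space A). u *v x = const_vec (coeff_vec x 0)"
proof -
  have "\<exists>u\<in>elem_group (coord_space A). u *v x = const_vec (coeff_vec x 0)"
    if "\<And>i. i > r \<Longrightarrow> coeff_vec x i = 0" for r
    using assms that
  proof (induction r arbitrary: x y)
    case 0
    then have "mat 1 *v x = const_vec (coeff_vec x 0)"
      by (simp add: vec_eq_iff_coeff_vec coeff_vec_const)
    then show ?case using elem_group.one by blast
  next
    case (Suc r)
    show ?case
    proof (cases "coeff_vec x (Suc r) = 0")
      case True
      then have "coeff_vec x i = 0" if "i > r" for i
        using Suc.prems(4)[of i] that by (cases "i = Suc r") auto
      then show ?thesis using Suc.IH[OF Suc.prems(1-3)] by blast
    next
      case False
      obtain u where u: "u \<in> elem_group (coord_space A)"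
        "\<And>i. i \<ge> Suc r \<Longrightarrow> coeff_vec (u *v x) i = 0"
        using lower_degree[OF Suc.prems(1-3) _ False Suc.prems(4)] by auto
      have "\<exists>u'\<in>elem_group (coord_space A). u' *v (u *v x) = const_vec (coeff_vec (u *v x) 0)"
      proof (rule Suc.IH[of "u *v x" "u *v y"])
        show "coeff_vec (u *v x) i \<in> coord_space A" for i
          using elem_group_coord_space[OF u(1) Suc.prems(1)] .
      qed (use u Suc.prems in \<open>auto simp: elem_group_form[OF u(1)]\<close>)
      then show ?thesis using u(1)
        by (auto simp: matrix_vector_mul_assoc elem_group_coeff_0 intro: elem_group_mult)
    qed
  qed
  then show ?thesis using coeff_vec_eventually_0[of x] by blast
qed

text \<open>All generators used are along \<open>e\<close> and fix it. Since
  \<open>\<langle>e, y\<rangle>\<close> is the constant \<open>2\<close>, Siegel transformations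
  move the coefficients of positive degree, from the top down, into the line of \<open>e\<close>;
  transvections then remove these multiples of \<open>e\<close>, again from the top.\<close>

lemma elem_group_straighten:
  assumes "e \<in> coord_space A" "pq_form e e = 0" "pq_form e f = 2"
    and "\<And>i. coeff_vec y i \<in> coord_space A" "poly_form y y = 0" 
    and "poly_form (const_vec e) y = [:2:]" "coeff_vec y 0 = f"
  shows "\<exists>u\<in>elem_group (coord_space A). u *v const_vec e = const_vec e \<and> u *v y = const_vec f"
proof -
  have fe: "pq_form f e = 2" using pq_form_cnj[of e f] assms(3) by simp
  have q: "pq_form e (coeff_vec y i) = (if i = 0 then 2 else 0)"
    if "poly_form (const_vec e) y = [:2:]" for i y
    using coeff_poly_form_const[of e y i] that by (simp add: coeff_pCons split: nat.splits)
  have on_line: "\<exists>u\<in>elem_group (coord_space A). u *v const_vec e = const_vec e \<and> u *v y = const_vec f"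
    if "\<And>i. coeff_vec y i \<in> coord_space A" "poly_form y y = 0" 
     "poly_form (const_vec e) y = [:2:]" "coeff_vec y 0 = f" 
     "\<And>i. i \<ge> 1 \<Longrightarrow> \<exists>c. coeff_vec y i = c *s e" "\<And>i. i > r \<Longrightarrow> coeff_vec y i = 0" for r y
    using that
  proof (induction r arbitrary: y)
    case 0
    then have "mat 1 *v y = const_vec f"
      by (simp add: vec_eq_iff_coeff_vec coeff_vec_const)
    then show ?case by (intro bexI[of _ "mat 1"] elem_group.one) auto
  next
    case (Suc r)
    obtain b where b: "coeff_vec y (Suc r) = b *s e" using Suc.prems(5) by auto
    \<comment> \<open>Coefficients of positive degree lie on the isotropic line of \<open>e\<close>,
      so they pair to zero among themselves and only pairs with the constant term \<open>f\<close>
      survive. They force \<open>b\<close> to be purely imaginary.\<close>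
    have "(\<Sum>i\<le>Suc r. pq_form (coeff_vec y i) (coeff_vec y (Suc r - i))) =
        (\<Sum>i\<in>{0, Suc r}. pq_form (coeff_vec y i) (coeff_vec y (Suc r - i)))"
    proof (rule sum.mono_neutral_right)
      show "\<forall>i\<in>{..Suc r} - {0, Suc r}. pq_form (coeff_vec y i) (coeff_vec y (Suc r - i)) = 0"
      proof
        fix i assume "i \<in> {..Suc r} - {0, Suc r}"
        then have "i \<ge> 1" "Suc r - i \<ge> 1" by auto
        then show "pq_form (coeff_vec y i) (coeff_vec y (Suc r - i)) = 0"
          using Suc.prems(5)[of i] Suc.prems(5)[of "Suc r - i"] assms(2) by (auto simp: pq_form_linear)
      qed
    qed auto
    then have "coeff (poly_form y y) (Suc r) = pq_form f (b *s e) + pq_form (b *s e) f"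
      by (simp only: coeff_poly_form) (simp add: b Suc.prems(4))
    then have "b * 2 + cnj b * 2 = 0"
      by (simp add: Suc.prems(2) pq_form_linear assms(3) fe)
    then have bi: "b = \<i> * of_real (Im b)" by (simp add: complex_eq_iff)
    \<comment> \<open>In degree \<open>Suc r\<close> this adds
      \<open>\<i> c \<langle>e, f\<rangle> e = 2 \<i> c e\<close>, which is \<open>- b *s e\<close>
      for \<open>c = - Im b / 2\<close>.\<close>
    define u where "u = m_elt (- Im b / 2) e (Suc r)"
    have u: "u \<in> elem_group (coord_space A)"
      using assms by (auto simp: u_def intro: elem_group_m)
    have ue: "u *v const_vec e = const_vec e"
      by (simp add: u_def m_elt_fix assms)
    have cu: "coeff_vec (u *v y) i = coeff_vec y i - (if i = Suc r then b *s e else 0)" for i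
    proof -
      have "\<i> * of_real (- Im b / 2) * 2 = - b" by (subst (2) bi) simp
      then show ?thesis
        unfolding u_def coeff_vec_m_elt q[OF Suc.prems(3)] by (auto simp: vec_eq_iff)
    qed
    have "\<exists>u'\<in>elem_group (coord_space A). u' *v const_vec e = const_vec e \<and>
        u' *v (u *v y) = const_vec f"
    proof (rule Suc.IH)
      show "coeff_vec (u *v y) i \<in> coord_space A" for i
        using elem_group_coord_space[OF u Suc.prems(1)] .
      show "poly_form (u *v y) (u *v y) = 0" using u Suc.prems by (simp add: elem_group_form)
      show "poly_form (const_vec e) (u *v y) = [:2:]"
        using elem_group_form[OF u, of "const_vec e" y] ue Suc.prems by simp
      show "coeff_vec (u *v y) 0 = f" using u Suc.prems by (simp add: elem_group_coeff_0)
      show "\<exists>c. coeff_vec (u *v y) i = c *s e" if "i \<ge> 1" for i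
        using cu[of i] Suc.prems(5)[OF that] b by (auto intro: exI[of _ 0])
      show "coeff_vec (u *v y) i = 0" if "i > r" for i
        using cu[of i] Suc.prems(6)[of i] that b by auto
    qed
    then show ?case using u ue
      by (metis elem_group_mult matrix_vector_mul_assoc)
  qed
  have general: "\<exists>u\<in>elem_group (coord_space A). u *v const_vec e = const_vec e \<and> u *v y = const_vec f"
    if "\<And>i. coeff_vec y i \<in> coord_space A" "poly_form y y = 0" 
     "poly_form (const_vec e) y = [:2:]" "coeff_vec y 0 = f" 
     "\<And>i. i > r \<Longrightarrow> \<exists>c. coeff_vec y i = c *s e" for r y
    using that
  proof (induction r arbitrary: y)
    case 0
    obtain r where "\<And>i. i > r \<Longrightarrow> coeff_vec y i = 0" using coeff_vec_eventually_0 by blast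
    from on_line[OF 0(1-4) _ this] 0(5) show ?case by auto
  next
    case (Suc r)
    \<comment> \<open>Modulo \<open>e\<close> the transformation changes \<open>y\<close> only by
      \<open>- \<langle>e, f\<rangle> w = - 2 w\<close> in degree \<open>Suc r\<close>, hence the
      factor one half.\<close>
    define w where "w = (1 / 2) *s coeff_vec y (Suc r)"
    define u where "u = n_elt e w (Suc r)"
    have ew: "pq_form e w = 0" using q[OF Suc.prems(3)] by (simp add: w_def pq_form_linear)
    then have we: "pq_form w e = 0" by (rule pq_form_eq_0_sym)
    have wZ: "w \<in> coord_space A" using Suc.prems(1) by (auto simp: w_def coord_space_def)
    have u: "u \<in> elem_group (coord_space A)"
      using assms wZ ew by (auto simp: u_def intro: elem_group_n)
    have ue: "u *v const_vec e = const_vec e"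
      by (simp add: u_def n_elt_fix assms we)
    have cu: "\<exists>c. coeff_vec (u *v y) i = coeff_vec y i - (if i = Suc r then coeff_vec y i else 0) + c *s e" for i
    proof -
      have w2: "(2::complex) *s w = coeff_vec y (Suc r)" by (simp add: w_def)
      show ?thesis
        unfolding u_def coeff_vec_n_elt q[OF Suc.prems(3)]
        by (rule exI[of _ "(if i < Suc r then 0 else pq_form w (coeff_vec y (i - Suc r))) -
          (if i < 2 * Suc r then 0 else pq_form w w / 2 * (if i - 2 * Suc r = 0 then 2 else 0))"])
         (use w2 in \<open>auto simp: vec_eq_iff algebra_simps\<close>)
    qed
    have "\<exists>u'\<in>elem_group (coord_space A). u' *v const_vec e = const_vec e \<and>
        u' *v (u *v y) = const_vec f"
    proof (rule Suc.IH)
      show "coeff_vec (u *v y) i \<in> coord_space A" for i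
        using elem_group_coord_space[OF u Suc.prems(1)] .
      show "poly_form (u *v y) (u *v y) = 0" using u Suc.prems by (simp add: elem_group_form)
      show "poly_form (const_vec e) (u *v y) = [:2:]"
        using elem_group_form[OF u, of "const_vec e" y] ue Suc.prems by simp
      show "coeff_vec (u *v y) 0 = f" using u Suc.prems by (simp add: elem_group_coeff_0)
      show "\<exists>c. coeff_vec (u *v y) i = c *s e" if "i > r" for i
      proof (cases "i = Suc r")
        case True
        then show ?thesis using cu[of i] by auto
      next
        case False
        then obtain c where "coeff_vec y i = c *s e" using Suc.prems(5)[of i] \<open>i > r\<close> by auto
        moreover obtain c' where "coeff_vec (u *v y) i = coeff_vec y i + c' *s e"
          using cu[of i] False by auto
        ultimately have "coeff_vec (u *v y) i = (c + c') *s e"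
          by (simp only: vec.scale_left_distrib)
        then show ?thesis by blast
      qed
    qed
    then show ?case using u ue
      by (metis elem_group_mult matrix_vector_mul_assoc)
  qed
  obtain r where r: "\<And>i. i > r \<Longrightarrow> coeff_vec y i = 0 *s e"
    using coeff_vec_eventually_0[of y] by auto
  show ?thesis by (rule general[OF assms(4-7)]) (use r in blast)
qed

section \<open>Generation of the polynomial isometry group\<close>

text \<open>The form that the reality condition and \<open>g(\<infinity>) = I\<close> take in the
  variable \<open>t\<close>; the point at infinity becomes \<open>t = 0\<close>.\<close>

definition based_isometry :: "complex poly ^ ('p::finite + 'q::finite) ^ ('p + 'q) \<Rightarrow> bool" where
  "based_isometry P \<longleftrightarrow> (\<forall>x y. poly_form (P *v x) (P *v y) = poly_form x y) \<and>
     (\<forall>x. coeff_vec (P *v x) 0 = coeff_vec x 0)"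

lemma based_isometry_elem_group: "u \<in> elem_group Z \<Longrightarrow> based_isometry u"
  by (simp add: based_isometry_def elem_group_form elem_group_coeff_0)

lemma based_isometry_mult: "based_isometry P \<Longrightarrow> based_isometry Q \<Longrightarrow> based_isometry (P ** Q)"
  by (simp add: based_isometry_def flip: matrix_vector_mul_assoc)

text \<open>An isometry that fixes the basis vectors indexed by \<open>A\<close> preserves their
  orthogonal complement.\<close>

lemma based_isometry_coord_space:
  assumes P: "based_isometry P"
    and fixed: "\<And>a. a \<in> A \<Longrightarrow> P *v const_vec (axis a 1) = const_vec (axis a 1)"
    and h: "h \<in> coord_space A"
  shows "coeff_vec (P *v const_vec h) i \<in> coord_space A"
proof -
  have "coeff_vec (P *v const_vec h) i $ a = 0" if a: "a \<in> A" for a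
  proof -
    have "poly_form (const_vec (axis a 1)) (P *v const_vec h) = poly_form (const_vec (axis a 1)) (const_vec h)"
      using P fixed[OF a] unfolding based_isometry_def by metis
    also have "\<dots> = 0" using h a by (simp add: poly_form_const pq_form_axis coord_space_def)
    finally have "pq_form (axis a 1) (coeff_vec (P *v const_vec h) i) = 0"
      by (metis coeff_poly_form_const coeff_0)
    then show ?thesis by (simp add: pq_form_axis pq_sign_def split: sum.splits)
  qed
  then show ?thesis by (simp add: coord_space_def)
qed

text \<open>The plane of \<open>Inl i\<close> and \<open>Inr j\<close> has the hyperbolic basis
  \<open>e\<close>, \<open>f\<close> of isotropic vectors with pairing \<open>2\<close>. First the
  image of \<open>e\<close> is made constant, then that of \<open>f\<close> is straightened while
  \<open>e\<close> stays fixed.\<close>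

lemma elem_group_fixes_plane:
  assumes Q: "based_isometry Q"
    and fixed: "\<And>c. c \<in> A \<Longrightarrow> Q *v const_vec (axis c 1) = const_vec (axis c 1)"
    and ij: "Inl i \<notin> A" "Inr j \<notin> A"
  shows "\<exists>u\<in>elem_group UNIV. \<forall>c\<in>insert (Inl i) (insert (Inr j) A).
     (u ** Q) *v const_vec (axis c 1) = const_vec (axis c 1)"
proof -
  let ?a = "Inl i" and ?b = "Inr j"
  define e where "e = axis ?a 1 + axis ?b (1::complex)"
  define f where "f = axis ?b 1 - axis ?a (1::complex)"
  have Z: "e \<in> coord_space A" "f \<in> coord_space A"
    using ij by (auto simp: e_def f_def coord_space_def axis_def)
  have ef: "pq_form e e = 0" "pq_form f f = 0" "pq_form e f = 2" "pq_form f e = 2"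
    by (simp_all add: e_def f_def pq_form_linear pq_form_axis pq_sign_def) (simp_all add: axis_def)
  have coord: "coeff_vec (Q *v const_vec h) m \<in> coord_space A" if "h \<in> coord_space A" for h m
    using based_isometry_coord_space[OF Q fixed that] .
  have Qform: "poly_form (Q *v x) (Q *v y) = poly_form x y" for x y
    using Q by (simp add: based_isometry_def)
  have Q0: "coeff_vec (Q *v const_vec h) 0 = h" for h
    using Q by (simp add: based_isometry_def coeff_vec_const)
  \<comment> \<open>Half the image of \<open>f\<close> is the witness of unimodularity for the image
    of \<open>e\<close>.\<close>
  have "poly_form ([:1 / 2:] *s (Q *v const_vec f)) (Q *v const_vec e) = 1"
    by (simp add: poly_form_linear Qform poly_form_const ef one_pCons)
  moreover have "poly_form (Q *v const_vec e) (Q *v const_vec e) = 0"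
    by (simp add: Qform poly_form_const ef)
  ultimately obtain u1 where u1: "u1 \<in> elem_group (coord_space A)" "u1 *v (Q *v const_vec e) = const_vec e"
    using elem_group_makes_constant[of "Q *v const_vec e" A] coord[OF Z(1)] Q0 by metis
  define y where "y = u1 *v (Q *v const_vec f)"
  have y: "coeff_vec y m \<in> coord_space A" for m
    unfolding y_def by (rule elem_group_coord_space[OF u1(1) coord[OF Z(2)]])
  have "poly_form y y = 0"
    by (simp add: y_def elem_group_form[OF u1(1)] Qform poly_form_const ef)
  moreover have "poly_form (const_vec e) y = [:2:]"
    using elem_group_form[OF u1(1), of "Q *v const_vec e" "Q *v const_vec f"]
    by (simp add: u1(2) y_def Qform poly_form_const ef)
  moreover have "coeff_vec y 0 = f" by (simp add: y_def elem_group_coeff_0[OF u1(1)] Q0)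
  ultimately obtain u2 where u2: "u2 \<in> elem_group (coord_space A)"
     "u2 *v const_vec e = const_vec e" "u2 *v y = const_vec f"
    using elem_group_straighten[OF Z(1) ef(1,3) y] by auto
  define R where "R = (u2 ** u1) ** Q"
  have Re: "R *v const_vec e = const_vec e" and Rf: "R *v const_vec f = const_vec f"
    using u1 u2 by (simp_all add: R_def y_def flip: matrix_vector_mul_assoc)
  have "axis ?a 1 = (1 / 2) *s (e - f)" "axis ?b 1 = (1 / 2) *s (e + f)"
    by (auto simp: e_def f_def vec_eq_iff axis_def)
  moreover have "R *v (c *s x) = c *s (R *v x)" for c x
    by (simp add: vec_eq_iff matrix_vector_mult_def sum_distrib_left mult_ac)
  ultimately have "R *v const_vec (axis ?a 1) = const_vec (axis ?a 1)"
    "R *v const_vec (axis ?b 1) = const_vec (axis ?b 1)"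
    by (simp_all add: const_vec_scale const_vec_add const_vec_diff matrix_vector_mult_diff_distrib
      matrix_vector_right_distrib Re Rf)
  moreover have "R *v const_vec (axis c 1) = const_vec (axis c 1)" if c: "c \<in> A" for c
  proof -
    \<comment> \<open>The generators of \<open>u\<close> use only vectors of
      \<open>coord_space A\<close>, which are orthogonal to this basis vector; so the earlier planes
      are not disturbed.\<close>
    have "u *v const_vec (axis c 1) = const_vec (axis c 1)" if "u \<in> elem_group (coord_space A)" for u
      by (rule elem_group_fix[OF that], rule pq_form_eq_0_sym)
       (use c in \<open>simp add: pq_form_axis coord_space_def\<close>)
    then show ?thesis using u1 u2 fixed[OF c] by (simp add: R_def flip: matrix_vector_mul_assoc)
  qed
  moreover have "u2 ** u1 \<in> elem_group UNIV"
    using u1 u2 by (auto intro: elem_group_mult elem_group_mono)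
  ultimately show ?thesis unfolding R_def by blast
qed

text \<open>Images of the remaining basis vectors have all coefficients in a positive definite
  space. A top coefficient of degree \<open>s \<ge> 1\<close> would have norm zero by comparison in
  degree \<open>s + s\<close>, so the images are constant.\<close>

lemma based_isometry_definite:
  fixes P :: "complex poly ^ ('p::finite + 'q::finite) ^ ('p + 'q)"
  assumes P: "based_isometry P"
    and fixed: "\<And>i. P *v const_vec (axis (Inl i) 1) = const_vec (axis (Inl i) 1)"
  shows "P = mat 1"
proof -
  have "P *v const_vec (axis c 1) = const_vec (axis c 1)" for c
  proof (cases c)
    case (Inl i)
    then show ?thesis using fixed by simp
  next
    case (Inr j)
    define x where "x = P *v const_vec (axis c 1)"
    define X where "X = coeff_vec x"
    have X: "X m \<in> coord_space (range Inl)" for m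
      unfolding X_def x_def using fixed Inr
      by (intro based_isometry_coord_space[OF P]) (auto simp: coord_space_def axis_def)
    have "poly_form x x = [:pq_form (axis c 1) (axis c 1):]"
      using P by (simp add: x_def based_isometry_def poly_form_const)
    have zero: "X m = 0" if "m \<ge> 1" for m
    proof (rule ccontr)
      assume m: "X m \<noteq> 0"
      obtain r where r: "\<And>i. i > r \<Longrightarrow> X i = 0"
        unfolding X_def using coeff_vec_eventually_0 by blast
      have "{i. X i \<noteq> 0} \<subseteq> {..r}" using r by (auto simp flip: not_less)
      then have fin: "finite {i. X i \<noteq> 0}" by (rule finite_subset) simp
      define s where "s = Max {i. X i \<noteq> 0}"
      have Xs: "X s \<noteq> 0" using Max_in[OF fin] m by (auto simp: s_def)
      have above: "X i = 0" if "i > s" for i using Max_ge[OF fin] that by (fastforce simp: s_def)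
      have s: "s \<ge> 1" using Max_ge[OF fin, of m] m \<open>m \<ge> 1\<close> by (auto simp: s_def)
      have "(\<Sum>i\<le>s + s. pq_form (X i) (X (s + s - i))) = (\<Sum>i\<in>{s}. pq_form (X i) (X (s + s - i)))"
      proof (rule sum.mono_neutral_right)
        show "\<forall>i\<in>{..s + s} - {s}. pq_form (X i) (X (s + s - i)) = 0"
        proof
          fix i assume "i \<in> {..s + s} - {s}"
          then have "i > s \<or> s + s - i > s" by auto
          then show "pq_form (X i) (X (s + s - i)) = 0" using above by auto
        qed
      qed auto
      moreover have "coeff (poly_form x x) (s + s) = 0"
        using \<open>poly_form x x = _\<close> s by (simp add: coeff_pCons split: nat.split)
      ultimately have "pq_form (X s) (X s) = 0" by (simp add: coeff_poly_form X_def)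
      moreover have "pq_form (X s) (X s) = of_real (\<Sum>i\<in>UNIV. (cmod (X s $ Inr i))\<^sup>2)"
        using X[of s] by (simp add: pq_form_def coord_space_def mult.commute[of "cnj _"] flip: complex_norm_square)
      ultimately have "(\<Sum>i\<in>UNIV. (cmod (X s $ Inr i))\<^sup>2) = 0" by (simp only: of_real_eq_0_iff)
      then have "X s $ Inr i = 0" for i by (simp add: sum_nonneg_eq_0_iff)
      then have "X s $ c = 0" for c using X[of s] by (cases c) (auto simp: coord_space_def)
      then show False using Xs by (simp add: vec_eq_iff)
    qed
    have "X 0 = axis c 1" using P by (simp add: X_def x_def based_isometry_def coeff_vec_const)
    then have "x = const_vec (axis c 1)"
      using zero by (auto simp: vec_eq_iff_coeff_vec coeff_vec_const X_def)
    then show ?thesis by (simp add: x_def)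
  qed
  moreover have "const_vec (axis c 1) = axis c 1" for c :: "'p + 'q"
    by (simp add: const_vec_def axis_def vec_eq_iff one_pCons)
  ultimately have "(P *v axis c 1) $ b = axis c 1 $ b" for b c by simp
  then have "P $ b $ c = (if b = c then 1 else 0)" for b c
    by (simp add: matrix_vector_mult_def axis_def if_distrib cong: if_cong)
  then show ?thesis by (simp add: vec_eq_iff mat_def)
qed

text \<open>The injection \<open>\<iota>\<close>, available because \<open>p \<le> q\<close>, pairs
  every negative index with a positive one. These hyperbolic planes are fixed one after another,
  until all negative basis vectors are fixed and the definite case applies.\<close>

theorem based_isometry_in_elem_group:
  fixes P :: "complex poly ^ ('p::finite + 'q::finite) ^ ('p + 'q)"
  assumes "CARD('p) \<le> CARD('q)" and P: "based_isometry P"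
  shows "P \<in> elem_group UNIV"
proof -
  obtain \<iota> :: "'p \<Rightarrow> 'q" where \<iota>: "inj \<iota>"
    using card_le_inj[of "UNIV :: 'p set" "UNIV :: 'q set"] assms(1) by auto
  have "\<exists>u\<in>elem_group UNIV. \<forall>c\<in>Inl ` S \<union> Inr ` \<iota> ` S.
      (u ** P) *v const_vec (axis c 1) = const_vec (axis c 1)" if "finite S" for S
    using that
  proof induction
    case empty
    then show ?case using elem_group.one by auto
  next
    case (insert i S)
    then obtain u where u: "u \<in> elem_group UNIV"
      "\<And>c. c \<in> Inl ` S \<union> Inr ` \<iota> ` S \<Longrightarrow> (u ** P) *v const_vec (axis c 1) = const_vec (axis c 1)"
      by blast
    define A where "A = Inl ` S \<union> Inr ` \<iota> ` S"
    have "based_isometry (u ** P)"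
      using u(1) P by (simp add: based_isometry_mult based_isometry_elem_group)
    moreover have "Inl i \<notin> A" "Inr (\<iota> i) \<notin> A"
      using insert(2) \<iota> by (auto simp: A_def dest: injD)
    ultimately obtain u' where u': "u' \<in> elem_group UNIV"
      "\<And>c. c \<in> insert (Inl i) (insert (Inr (\<iota> i)) A) \<Longrightarrow>
         (u' ** (u ** P)) *v const_vec (axis c 1) = const_vec (axis c 1)"
      using elem_group_fixes_plane[of "u ** P" A i "\<iota> i"] u(2) unfolding A_def by metis
    have "Inl ` insert i S \<union> Inr ` \<iota> ` insert i S = insert (Inl i) (insert (Inr (\<iota> i)) A)"
      by (auto simp: A_def)
    then show ?case using u(1) u'
      by (intro bexI[of _ "u' ** u"] elem_group_mult) (auto simp flip: matrix_mul_assoc)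
  qed
  from this[of UNIV] obtain u where u: "u \<in> elem_group UNIV"
    "\<And>i. (u ** P) *v const_vec (axis (Inl i) 1) = const_vec (axis (Inl i) 1)"
    by auto
  have "u ** P = mat 1"
    using based_isometry_mult[OF based_isometry_elem_group[OF u(1)] P] u(2)
    by (rule based_isometry_definite)
  moreover obtain u' where u': "u' \<in> elem_group UNIV" "u' ** u = mat 1"
    using elem_group_left_inverse[OF u(1)] .
  ultimately have "P = u'" by (metis matrix_mul_assoc matrix_mul_lid matrix_mul_rid)
  then show ?thesis using u' by simp
qed

section \<open>Matrix properties of the generators\<close>

lemma sig_mat_component: "sig_mat $ a $ b = (if a = b then pq_sign a else 0)"
  by (simp add: sig_mat_def pq_sign_def)

lemma pq_sign_square_left [simp]: "pq_sign a * (pq_sign a * z) = z"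
  by (simp flip: mult.assoc)

lemma sig_mat_mult: "(sig_mat *v v) $ a = pq_sign a * v $ a"
  by (simp add: matrix_vector_mult_def sig_mat_component if_distrib if_distribR cong: if_cong)

lemma pq_form_sig_mat: "pq_form (sig_mat *v v) w = (\<Sum>a\<in>UNIV. cnj (v $ a) * w $ a)"
  by (simp add: pq_form_altdef sig_mat_mult mult.assoc)

lemma pq_form_sig_mat_self: "pq_form (sig_mat *v v) v = 0 \<longleftrightarrow> v = 0"
proof -
  have "pq_form (sig_mat *v v) v = of_real (\<Sum>a\<in>UNIV. (cmod (v $ a))\<^sup>2)"
    by (simp add: pq_form_sig_mat mult.commute[of "cnj _"] flip: complex_norm_square)
  then show ?thesis
    by (simp only: of_real_eq_0_iff) (auto simp: sum_nonneg_eq_0_iff vec_eq_iff)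
qed

lemma adj_component: "adj A $ a $ b = pq_sign a * cnj (A $ b $ a) * pq_sign b"
  by (simp add: adj_def matrix_matrix_mult_def sig_mat_component transpose_def if_distrib if_distribR
      cong: if_cong)

lemma adj_outer: "adj (outer v w) = outer w v"
  by (simp add: vec_eq_iff adj_component outer_def mult_ac)

lemma outer_scale: "outer (c *s v) w = outer v (cnj c *s w)"
  by (simp add: vec_eq_iff outer_def)

lemma outer_times_outer: "outer v w ** outer x y = outer (pq_form w x *s v) y"
  by (simp add: matrix_eq outer_mult pq_form_linear mult.commute flip: matrix_vector_mul_assoc)

text \<open>The linear functional \<open>\<langle>w, _\<rangle>\<close> as a row. The rows of outer
  products are multiples of such rows, so ranks can be read off from row spaces.\<close>

definition form_row :: "complex ^ ('p::finite + 'q::finite) \<Rightarrow> complex ^ ('p + 'q)" where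
  "form_row w = (\<chi> b. pq_sign b * cnj (w $ b))"

lemma pq_sign_nonzero: "pq_sign a \<noteq> 0"
  by (simp add: pq_sign_def split: sum.split)

lemma form_row_eq_scale: "form_row v = c *s form_row w \<longleftrightarrow> v = cnj c *s w"
proof -
  have "cnj x = c * cnj y \<longleftrightarrow> x = cnj c * y" for x y
    by (metis complex_cnj_cnj complex_cnj_mult)
  then show ?thesis by (simp add: form_row_def vec_eq_iff pq_sign_nonzero mult.left_commute)
qed

lemma form_row_eq_0: "form_row w = 0 \<longleftrightarrow> w = 0"
  using form_row_eq_scale[of w 0 w] by simp

lemma rows_outer: "row a (outer v w) = v $ a *s form_row w"
  by (simp add: row_def outer_def form_row_def vec_eq_iff)

lemma rank_outer:
  assumes "v \<noteq> 0" "w \<noteq> 0"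
  shows "rank (outer v w) = 1"
proof -
  have "vec.span (rows (outer v w)) = vec.span {form_row w}"
  proof (rule vec.span_eq[THEN iffD2], intro conjI)
    show "rows (outer v w) \<subseteq> vec.span {form_row w}"
      by (auto simp: rows_def rows_outer intro!: vec.span_scale intro: vec.span_base)
    obtain a where a: "v $ a \<noteq> 0" using assms(1) by (auto simp: vec_eq_iff)
    have "(1 / v $ a) *s row a (outer v w) \<in> vec.span (rows (outer v w))"
      by (intro vec.span_scale vec.span_base) (auto simp: rows_def)
    moreover have "(1 / v $ a) *s row a (outer v w) = form_row w"
      using a by (simp add: rows_outer)
    ultimately show "{form_row w} \<subseteq> vec.span (rows (outer v w))" by simp
  qed
  then have "vec.dim (rows (outer v w)) = vec.dim {form_row w}"
    by (metis vec.dim_span)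
  then show ?thesis using assms(2) by (simp add: row_rank_def_gen form_row_eq_0)
qed

lemma rank_outer_diff:
  assumes "v \<noteq> 0" "\<nexists>c. w = c *s v"
  shows "rank (outer v w - outer w v) = 2"
proof -
  let ?N = "outer v w - outer w v"
  have row: "row a ?N = v $ a *s form_row w - w $ a *s form_row v" for a
    by (simp add: row_def outer_def form_row_def vec_eq_iff)
  have "vec.span (rows ?N) = vec.span {form_row w, form_row v}"
  proof (rule vec.span_eq[THEN iffD2], intro conjI)
    show "rows ?N \<subseteq> vec.span {form_row w, form_row v}"
      by (auto simp: rows_def row intro!: vec.span_scale vec.span_diff intro: vec.span_base)
    obtain a where a: "v $ a \<noteq> 0" using assms(1) by (auto simp: vec_eq_iff)
    obtain b where b: "w $ b \<noteq> w $ a / v $ a * v $ b"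
      using assms(2)[simplified, rule_format, of "w $ a / v $ a"] unfolding vec_eq_iff by auto
    \<comment> \<open>A nonzero two-by-two minor; by Cramer's rule the rows \<open>a\<close> and
      \<open>b\<close> already recover \<open>form_row w\<close> and
      \<open>form_row v\<close>.\<close>
    define D where "D = v $ a * w $ b - w $ a * v $ b"
    have D: "D \<noteq> 0" using a b by (auto simp: D_def field_simps)
    have base: "row c ?N \<in> vec.span (rows ?N)" for c
      by (intro vec.span_base) (auto simp: rows_def)
    have "(1 / D) *s (w $ b *s row a ?N - w $ a *s row b ?N) = (1 / D) *s (D *s form_row w)"
      unfolding row D_def vec_eq_iff by (simp add: algebra_simps)
    then have "form_row w = (1 / D) *s (w $ b *s row a ?N - w $ a *s row b ?N)"
      using D by simp
    then have "form_row w \<in> vec.span (rows ?N)"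
      using base by (simp only: vec.span_scale vec.span_diff)
    moreover have "(1 / D) *s (v $ b *s row a ?N - v $ a *s row b ?N) = (1 / D) *s (D *s form_row v)"
      unfolding row D_def vec_eq_iff by (simp add: algebra_simps)
    then have "form_row v = (1 / D) *s (v $ b *s row a ?N - v $ a *s row b ?N)"
      using D by simp
    then have "form_row v \<in> vec.span (rows ?N)"
      using base by (simp only: vec.span_scale vec.span_diff)
    ultimately show "{form_row w, form_row v} \<subseteq> vec.span (rows ?N)" by simp
  qed
  then have "rank ?N = vec.dim {form_row w, form_row v}"
    unfolding row_rank_def_gen by (metis vec.dim_span)
  moreover have "form_row w \<notin> vec.span {form_row v}"
    using assms(2) by (auto simp: vec.span_singleton form_row_eq_scale)
  ultimately show ?thesis
    using assms(1) by (simp add: vec.dim_insert form_row_eq_0)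
qed

section \<open>Products of nilpotent loops\<close>

lemma const_rat_simps:
  "const_rat 0 = 0" "const_rat 1 = 1" "const_rat (a + b) = const_rat a + const_rat b"
  "const_rat (a * b) = const_rat a * const_rat b"
  by (simp_all add: const_rat_def flip: to_fract_add to_fract_mult one_pCons)

lemma const_rat_minus: "const_rat (- a) = - const_rat a"
  by (simp add: const_rat_def flip: to_fract_uminus)

lemma const_rat_half: "const_rat (a / 2) = const_rat a / 2"
proof -
  have "const_rat (a / 2) * const_rat 2 = const_rat a"
    by (simp flip: const_rat_simps(4))
  moreover have "const_rat 2 = 2"
    using const_rat_simps(3)[of 1 1] by (simp add: const_rat_simps)
  moreover have "const_rat 2 \<noteq> 0" by (simp add: const_rat_def)
  ultimately show ?thesis by (metis nonzero_mult_div_cancel_right)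
qed

lemma const_rat_sum: "const_rat (\<Sum>i\<in>A. f i) = (\<Sum>i\<in>A. const_rat (f i))"
  by (induction A rule: infinite_finite_induct) (simp_all add: const_rat_simps)

text \<open>Substitution of \<open>t = 1 / (\<lambda> - \<alpha>)\<close>; as a ring homomorphism it
  carries matrix products of polynomials to products of loops.\<close>

definition rat_of_poly :: "complex \<Rightarrow> complex poly \<Rightarrow> ratfun" where
  "rat_of_poly \<alpha> p = poly (map_poly const_rat p) (inv_lin \<alpha>)"

lemma rat_of_poly_add: "rat_of_poly \<alpha> (p + q) = rat_of_poly \<alpha> p + rat_of_poly \<alpha> q"
proof -
  have "map_poly const_rat (p + q) = map_poly const_rat p + map_poly const_rat q"
    by (rule poly_eqI) (simp add: coeff_map_poly const_rat_simps)
  then show ?thesis by (simp add: rat_of_poly_def)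
qed

lemma rat_of_poly_mult: "rat_of_poly \<alpha> (p * q) = rat_of_poly \<alpha> p * rat_of_poly \<alpha> q"
proof -
  have "map_poly const_rat (p * q) = map_poly const_rat p * map_poly const_rat q"
    by (rule poly_eqI) (simp add: coeff_map_poly coeff_mult const_rat_simps const_rat_sum)
  then show ?thesis by (simp add: rat_of_poly_def)
qed

lemma rat_of_poly_monom: "rat_of_poly \<alpha> (monom c k) = inv_lin \<alpha> ^ k * const_rat c"
  by (simp add: rat_of_poly_def map_poly_monom const_rat_simps poly_monom mult.commute)

lemma rat_of_poly_0 [simp]: "rat_of_poly \<alpha> 0 = 0"
  by (simp add: rat_of_poly_def)

lemma rat_of_poly_1 [simp]: "rat_of_poly \<alpha> 1 = 1"
  by (simp add: rat_of_poly_def const_rat_simps)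

lemma rat_of_poly_sum: "rat_of_poly \<alpha> (\<Sum>i\<in>A. f i) = (\<Sum>i\<in>A. rat_of_poly \<alpha> (f i))"
  by (induction A rule: infinite_finite_induct) (simp_all add: rat_of_poly_add)

definition rat_loop :: "complex \<Rightarrow> complex poly ^ 'n ^ 'm \<Rightarrow> ratfun ^ 'n ^ 'm" where
  "rat_loop \<alpha> P = map_matrix (rat_of_poly \<alpha>) P"

lemma rat_loop_mult: "rat_loop \<alpha> (P ** Q) = rat_loop \<alpha> P ** rat_loop \<alpha> Q"
  by (simp add: rat_loop_def vec_eq_iff matrix_matrix_mult_def rat_of_poly_sum rat_of_poly_mult)

lemma rat_loop_1: "rat_loop \<alpha> (mat 1) = mat 1"
  by (simp add: rat_loop_def vec_eq_iff mat_def)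

definition loop_products :: "(ratfun ^ 'n ^ 'n) set \<Rightarrow> (ratfun ^ 'n ^ 'n) set" where
  "loop_products L = {loop_product gs |gs. set gs \<subseteq> L}"

lemma loop_products_1: "mat 1 \<in> loop_products L"
  unfolding loop_products_def by (force simp: loop_product_def intro: exI[of _ "[]"])

lemma loop_product_append: "loop_product (gs @ hs) = loop_product gs ** loop_product hs"
  by (induction gs) (simp_all add: loop_product_def matrix_mul_assoc)

lemma loop_products_mult:
  assumes "g \<in> loop_products L" "h \<in> loop_products L"
  shows "g ** h \<in> loop_products L"
proof -
  obtain gs hs where "g = loop_product gs" "set gs \<subseteq> L" "h = loop_product hs" "set hs \<subseteq> L"
    using assms by (auto simp: loop_products_def)
  then show ?thesis
    unfolding loop_products_def
    by (auto simp: loop_product_append intro!: exI[of _ "gs @ hs"])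
qed

lemma loop_products_generator: "g \<in> L \<Longrightarrow> g \<in> loop_products L"
  unfolding loop_products_def by (auto simp: loop_product_def intro!: exI[of _ "[g]"])

lemma loop_products_mono: "g \<in> loop_products L \<Longrightarrow> L \<subseteq> L' \<Longrightarrow> g \<in> loop_products L'"
  by (auto simp: loop_products_def)

lemma rat_loop_m_elt:
  assumes "pq_form v v = 0" "k \<ge> 1"
  shows "rat_loop \<alpha> (m_elt c v k) \<in> loop_products (m_type_loops \<alpha>)"
proof (cases "v = 0 \<or> c = 0")
  case True
  \<comment> \<open>The identity is not of type \<open>m\<close>, since the rank would be zero; it
    is represented by the empty product.\<close>
  then have "m_elt c v k = mat 1"
    by (auto simp: m_elt_def monom_mat_def outer_def vec_eq_iff)
  then show ?thesis by (simp add: rat_loop_1 loop_products_1)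
next
  case False
  define N where "N = outer ((\<i> * of_real c) *s v) v"
  have "rat_loop \<alpha> (m_elt c v k) = m_loop \<alpha> k N"
    by (simp add: m_elt_def m_loop_def rat_loop_def monom_mat_def vec_eq_iff rat_of_poly_add
        rat_of_poly_monom mat_def N_def)
  moreover have "N ** N = 0"
    by (simp add: N_def outer_times_outer pq_form_linear assms) (simp add: outer_def vec_eq_iff)
  moreover have "adj N = - N"
    unfolding N_def adj_outer by (subst outer_scale) (simp add: outer_def vec_eq_iff)
  moreover have "rank N = 1"
    unfolding N_def using False by (intro rank_outer) auto
  ultimately show ?thesis
    using assms(2) by (intro loop_products_generator) (auto simp: m_type_loops_def)
qed

lemma rat_loop_n_elt_isotropic:
  assumes "pq_form v v = 0" "pq_form v w = 0" "pq_form w w = 0" "k \<ge> 1"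
  shows "rat_loop \<alpha> (n_elt v w k) \<in> loop_products (m_type_loops \<alpha>)"
proof -
  have "pq_form w v = 0" using assms(2) by (rule pq_form_eq_0_sym)
  then show ?thesis
    unfolding n_elt_isotropic[OF assms(1-3)] rat_loop_mult
    by (intro loop_products_mult rat_loop_m_elt assms(4)) (simp_all add: assms pq_form_linear)
qed

lemma rat_loop_n_elt_add:
  assumes v: "pq_form v v = 0" "pq_form v w = 0" "pq_form v w' = 0" and k: "k \<ge> 1"
    and L: "m_type_loops \<alpha> \<subseteq> L"
    and w: "rat_loop \<alpha> (n_elt v w k) \<in> loop_products L" "rat_loop \<alpha> (n_elt v w' k) \<in> loop_products L"
  shows "rat_loop \<alpha> (n_elt v (w + w') k) \<in> loop_products L"
  unfolding n_elt_add[OF v] rat_loop_mult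
  by (intro loop_products_mult w loop_products_mono[OF rat_loop_m_elt L]) (use v k in auto)

text \<open>The map is \<open>M = outer v z\<close> for the line \<open>V\<close> of
  \<open>v\<close>. It kills \<open>V \<oplus> sV\<close> because \<open>z\<close> is orthogonal to
  \<open>v\<close> and \<open>sv\<close>. As \<open>\<langle>sv, v\<rangle> \<noteq> 0\<close>, a
  nonzero \<open>z\<close> is no multiple of \<open>v\<close>, which gives rank two.\<close>

lemma n_loop_in_n_type_loops:
  assumes V: "maximal_isotropic {c *s v |c. True}" and "v \<noteq> 0"
    and z: "pq_form v z = 0" "pq_form (sig_mat *v v) z = 0" "z \<noteq> 0" and k: "k \<ge> 1"
  shows "rat_loop \<alpha> (n_elt v z k) \<in> n_type_loops \<alpha>"
proof -
  let ?V = "{c *s v |c. True}"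
  define M where "M = outer v z"
  define N where "N = M - adj M"
  have N: "N = outer v z - outer z v" by (simp add: N_def M_def adj_outer)
  have vV: "v \<in> ?V" by (auto intro: exI[of _ 1])
  have vv: "pq_form v v = 0" using V vV unfolding maximal_isotropic_def isotropic_def by blast
  have zv: "pq_form z v = 0" "pq_form z (sig_mat *v v) = 0" using z by (auto intro: pq_form_eq_0_sym)
  have s: "sig_mat *v (c *s v) = c *s (sig_mat *v v)" for c
    by (rule vector_scalar_commute)
  have "\<forall>x\<in>V_plus_sV ?V. M *v x = 0"
    by (auto simp: V_plus_sV_def M_def outer_mult pq_form_linear zv s)
  moreover have "\<forall>x\<in>perp (V_plus_sV ?V). M *v x \<in> ?V"
    by (auto simp: M_def outer_mult)
  moreover have "rank M = 1" unfolding M_def using \<open>v \<noteq> 0\<close> z by (intro rank_outer)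
  moreover have "rank N = 2"
    unfolding N
  proof (rule rank_outer_diff[OF \<open>v \<noteq> 0\<close>], rule notI, elim exE)
    fix c assume c: "z = c *s v"
    then show False using z \<open>v \<noteq> 0\<close> by (auto simp: pq_form_linear pq_form_sig_mat_self)
  qed
  moreover have "rat_loop \<alpha> (n_elt v z k) = n_loop \<alpha> k N"
  proof -
    have "N ** N = outer (- pq_form z z *s v) v"
      unfolding N matrix_eq
      by (simp add: matrix_vector_mult_diff_rdistrib outer_mult pq_form_linear vv z zv
          vec_eq_iff flip: matrix_vector_mul_assoc)
    then show ?thesis
      by (simp add: n_elt_def n_loop_def rat_loop_def monom_mat_def vec_eq_iff rat_of_poly_add
        rat_of_poly_monom mat_def N) (simp add: outer_def const_rat_simps(4) const_rat_minus const_rat_half)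
  qed
  ultimately show ?thesis
    unfolding n_type_loops_def using V k N_def by blast
qed

section \<open>Isotropic vectors in an orthogonal complement, and maximal isotropic lines\<close>

lemma unit_vector_orthogonal_to:
  fixes a :: "'n::finite \<Rightarrow> complex"
  assumes "CARD('n) \<ge> 2"
  obtains x where "(\<Sum>i\<in>UNIV. cnj (a i) * x i) = 0" "(\<Sum>i\<in>UNIV. cnj (x i) * x i) = (1::complex)"
proof -
  obtain i j :: 'n where ij: "i \<noteq> j"
    using assms ex_card[of 2 "UNIV :: 'n set"] by (auto simp: card_2_iff)
  \<comment> \<open>Two coordinates suffice: the vector \<open>(cnj (a j), - cnj (a i))\<close>, or
    a basis vector in case both entries of \<open>a\<close> vanish.\<close>
  define y where "y = (if a i = 0 \<and> a j = 0 then (\<lambda>k. if k = i then 1 else 0)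
    else (\<lambda>k. if k = i then cnj (a j) else if k = j then - cnj (a i) else 0))"
  have "(\<Sum>k\<in>UNIV. cnj (a k) * y k) = (\<Sum>k\<in>{i, j}. cnj (a k) * y k)"
    by (rule sum.mono_neutral_right) (auto simp: y_def)
  then have y: "(\<Sum>k\<in>UNIV. cnj (a k) * y k) = 0"
    using ij by (auto simp: y_def)
  define s where "s = (\<Sum>k\<in>UNIV. (cmod (y k))\<^sup>2)"
  have "\<exists>k. y k \<noteq> 0"
    using ij by (auto simp: y_def intro: exI[of _ i] exI[of _ j])
  then have "s \<noteq> 0" by (simp add: s_def sum_nonneg_eq_0_iff)
  moreover have "s \<ge> 0" by (simp add: s_def sum_nonneg)
  ultimately have s: "s > 0" by simp
  define x where "x k = y k / of_real (sqrt s)" for k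
  have "(\<Sum>i\<in>UNIV. cnj (a i) * x i) = (\<Sum>k\<in>UNIV. cnj (a k) * y k) / of_real (sqrt s)"
    by (simp add: x_def sum_divide_distrib)
  moreover have "(\<Sum>i\<in>UNIV. cnj (x i) * x i) = of_real (\<Sum>i\<in>UNIV. (cmod (x i))\<^sup>2)"
    by (simp add: mult.commute[of "cnj _"] flip: complex_norm_square)
  moreover have "(\<Sum>i\<in>UNIV. (cmod (x i))\<^sup>2) = s / s"
    using s by (simp add: x_def norm_divide power_divide s_def[symmetric] sum_divide_distrib[symmetric])
  ultimately show ?thesis using that[of x] y s by simp
qed

text \<open>The condition on \<open>c\<close> is the real quadratic equation
  \<open>W + 2 * c * R + c * c * e = 0\<close>. Its reduced discriminant
  \<open>R\<^sup>2 - e * W\<close> is nonnegative by the sign condition, and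
  \<open>1 / e = e\<close>.\<close>

lemma isotropic_correction:
  assumes w: "pq_form w w = of_real W" and x: "pq_form x x = of_real e"
    and e: "e\<^sup>2 = 1" "e * W \<le> 0"
  obtains c :: real where "pq_form (w + of_real c *s x) (w + of_real c *s x) = 0"
proof
  define R where "R = Re (pq_form w x)"
  define D where "D = sqrt (R\<^sup>2 - e * W)"
  define c where "c = e * (D - R)"
  have "R\<^sup>2 - e * W \<ge> 0" using e(2) zero_le_power2[of R] by linarith
  then have "D\<^sup>2 = R\<^sup>2 - e * W" by (simp add: D_def)
  moreover have "e = 1 \<or> e = - 1" using e(1) by (simp add: power2_eq_1_iff)
  ultimately have *: "W + 2 * c * R + c * c * e = 0"
    by (auto simp: c_def power2_eq_square algebra_simps)
  have "pq_form x w = cnj (pq_form w x)" by (simp add: pq_form_cnj)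
  then have "pq_form (w + of_real c *s x) (w + of_real c *s x) = of_real (W + 2 * c * R + c * c * e)"
    by (simp add: pq_form_linear w x R_def complex_eq_iff algebra_simps)
  then show "pq_form (w + of_real c *s x) (w + of_real c *s x) = 0" using * by simp
qed

text \<open>Both definite parts have dimension at least two, so each contains a unit vector
  orthogonal to \<open>v\<close>. One of them corrects \<open>w\<close> to an isotropic vector; the
  correction itself is a sum of two isotropic vectors in the hyperbolic plane of both.\<close>

lemma isotropic_decomposition:
  fixes v w :: "complex ^ ('p::finite + 'q::finite)"
  assumes "CARD('p) \<ge> 2" "CARD('q) \<ge> 2" "pq_form v w = 0"
  obtains w1 w2 w3 where "w = w1 + (w2 + w3)" "pq_form v w1 = 0" "pq_form v w2 = 0" "pq_form v w3 = 0"
    "pq_form w1 w1 = 0" "pq_form w2 w2 = 0" "pq_form w3 w3 = 0"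
proof -
  note result = that
  obtain f where f: "(\<Sum>i\<in>UNIV. cnj (v $ Inl i) * f i) = 0" "(\<Sum>i\<in>UNIV. cnj (f i) * f i) = 1"
    using unit_vector_orthogonal_to[OF assms(1), of "\<lambda>i. v $ Inl i"] .
  obtain h where h: "(\<Sum>i\<in>UNIV. cnj (v $ Inr i) * h i) = 0" "(\<Sum>i\<in>UNIV. cnj (h i) * h i) = 1"
    using unit_vector_orthogonal_to[OF assms(2), of "\<lambda>i. v $ Inr i"] .
  define x :: "complex ^ ('p + 'q)" where "x = (\<chi> a. case a of Inl i \<Rightarrow> f i | Inr j \<Rightarrow> 0)"
  define y :: "complex ^ ('p + 'q)" where "y = (\<chi> a. case a of Inl i \<Rightarrow> 0 | Inr j \<Rightarrow> h j)"
  have xy: "pq_form v x = 0" "pq_form v y = 0" "pq_form x x = - 1" "pq_form y y = 1"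
    "pq_form x y = 0" "pq_form y x = 0"
    using f h by (simp_all add: pq_form_def x_def y_def)
  obtain W where W: "pq_form w w = of_real W" using pq_form_self_Re by blast
  \<comment> \<open>Here \<open>z\<close> is the unit vector whose sign \<open>e\<close> is opposite
    to that of \<open>W\<close>, and \<open>z'\<close> is the other one; \<open>z + z'\<close> and
    \<open>z - z'\<close> are isotropic.\<close>
  have main: ?thesis
    if z: "pq_form v z = 0" "pq_form z z = of_real e" "e\<^sup>2 = 1" "e * W \<le> 0"
      and z': "pq_form v z' = 0" "pq_form z' z' = of_real (- e)" "pq_form z z' = 0" "pq_form z' z = 0"
    for z z' and e :: real
  proof -
    obtain c :: real where c: "pq_form (w + of_real c *s z) (w + of_real c *s z) = 0"
      using isotropic_correction[OF W z(2-4)] .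
    define d :: complex where "d = - of_real c / 2"
    have "w = (w + of_real c *s z) + (d *s (z + z') + d *s (z - z'))"
      by (simp add: d_def vec_eq_iff algebra_simps)
    moreover have "pq_form v (w + of_real c *s z) = 0" "pq_form v (d *s (z + z')) = 0"
      "pq_form v (d *s (z - z')) = 0" "pq_form (d *s (z + z')) (d *s (z + z')) = 0"
      "pq_form (d *s (z - z')) (d *s (z - z')) = 0"
      using z z' assms(3) by (simp_all add: pq_form_linear)
    ultimately show ?thesis using c by (rule_tac result)
  qed
  show ?thesis
  proof (cases "W \<ge> 0")
    case True
    then show ?thesis using main[of x "-1" y] xy by simp
  next
    case False
    then show ?thesis using main[of y 1 x] xy by simp
  qed
qed

text \<open>With a single negative coordinate, an isotropic vector vanishing there is zero.
  Subtracting a multiple of \<open>v\<close> brings any vector of a larger isotropic space to this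
  situation.\<close>

lemma line_maximal_isotropic:
  fixes v :: "complex ^ ('p::finite + 'q::finite)"
  assumes p: "CARD('p) = 1" and v: "pq_form v v = 0" "v \<noteq> 0"
  shows "maximal_isotropic {c *s v |c. True}"
proof -
  obtain i :: 'p where i: "UNIV = {i}" using p by (auto simp: card_1_singleton_iff)
  have definite: "x = 0" if "pq_form x x = 0" "x $ Inl i = 0" for x :: "complex ^ ('p + 'q)"
  proof -
    have "pq_form x x = of_real (\<Sum>j\<in>UNIV. (cmod (x $ Inr j))\<^sup>2)"
      using that(2) by (simp add: pq_form_def i mult.commute[of "cnj _"] flip: complex_norm_square)
    then have "(\<Sum>j\<in>UNIV. (cmod (x $ Inr j))\<^sup>2) = 0" using that(1) by (metis of_real_eq_0_iff)
    then have "x $ Inr j = 0" for j by (simp add: sum_nonneg_eq_0_iff)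
    moreover have "x $ Inl j = 0" for j using that(2) i by (metis UNIV_I singletonD)
    ultimately have "x $ a = 0" for a by (cases a) auto
    then show ?thesis by (simp add: vec_eq_iff)
  qed
  have "vec.subspace {c *s v |c. True}"
    using vec.subspace_span[of "{v}"] by (simp add: vec.span_singleton full_SetCompr_eq)
  then have "isotropic {c *s v |c. True}"
    using v by (auto simp: isotropic_def pq_form_linear)
  moreover have "W = {c *s v |c. True}" if W: "isotropic W" "{c *s v |c. True} \<subseteq> W" for W
  proof -
    have vi: "v $ Inl i \<noteq> 0" using definite v by blast
    have vW: "v \<in> W" using W(2) by (auto intro: exI[of _ 1])
    have "x \<in> {c *s v |c. True}" if x: "x \<in> W" for x
    proof -
      let ?y = "x - (x $ Inl i / v $ Inl i) *s v"
      have "?y \<in> W" using W(1) x vW unfolding isotropic_def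
        by (metis vec.subspace_diff vec.subspace_scale)
      then have "pq_form ?y ?y = 0" using W(1) unfolding isotropic_def by blast
      then have "?y = 0" using vi by (intro definite) auto
      then show ?thesis by auto
    qed
    then show ?thesis using W(2) by blast
  qed
  ultimately show ?thesis by (simp add: maximal_isotropic_def)
qed

lemma rat_loop_n_elt:
  fixes v w :: "complex ^ ('p::finite + 'q::finite)"
  assumes pq: "CARD('p) \<le> CARD('q)" and v: "pq_form v v = 0" "pq_form v w = 0" and k: "k \<ge> 1"
  shows "rat_loop \<alpha> (n_elt v w k) \<in>
    loop_products (m_type_loops \<alpha> \<union> (if CARD('p) = CARD('q) then {} else n_type_loops \<alpha>))"
    (is "_ \<in> loop_products ?L")
proof -
  have trivial: "n_elt v z k = mat 1" if "v = 0 \<or> z = 0" for z :: "complex ^ ('p + 'q)"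
    using that by (elim disjE; hypsubst_thin; simp add: n_elt_def monom_mat_def outer_def vec_eq_iff)
  have mL: "m_type_loops \<alpha> \<subseteq> ?L" by simp
  consider "v = 0" | "CARD('p) \<ge> 2" | "v \<noteq> 0" "CARD('p) = 1"
    using zero_less_card_finite[where 'a='p] by linarith
  then show ?thesis
  proof cases
    case 1
    then show ?thesis using trivial[of w] by (metis rat_loop_1 loop_products_1)
  next
    case 2
    then have "CARD('q) \<ge> 2" using pq by simp
    then obtain w1 w2 w3 where w: "w = w1 + (w2 + w3)"
      "pq_form v w1 = 0" "pq_form v w2 = 0" "pq_form v w3 = 0"
      "pq_form w1 w1 = 0" "pq_form w2 w2 = 0" "pq_form w3 w3 = 0"
      using isotropic_decomposition[OF 2 _ v(2)] by blast
    have *: "rat_loop \<alpha> (n_elt v z k) \<in> loop_products ?L" if "pq_form v z = 0" "pq_form z z = 0" for z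
      using rat_loop_n_elt_isotropic[OF v(1) that k] mL by (rule loop_products_mono)
    show ?thesis
      unfolding w(1) using w v k mL
      by (intro rat_loop_n_elt_add *) (auto simp: pq_form_linear)
  next
    case 3
    \<comment> \<open>Projection along \<open>v\<close> makes \<open>z\<close> orthogonal to
      \<open>sv\<close> as well, as type \<open>n\<close> demands; the part \<open>b *s v\<close>
      only contributes a transvection.\<close>
    define b where "b = pq_form (sig_mat *v v) w / pq_form (sig_mat *v v) v"
    define z where "z = w - b *s v"
    have sv: "pq_form (sig_mat *v v) v \<noteq> 0" using 3 by (simp add: pq_form_sig_mat_self)
    have z: "pq_form v z = 0" "pq_form (sig_mat *v v) z = 0"
      using sv v by (simp_all add: z_def pq_form_linear b_def)
    have bv: "rat_loop \<alpha> (n_elt v (b *s v) k) \<in> loop_products ?L"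
      unfolding n_elt_self[OF v(1)] by (rule loop_products_mono[OF rat_loop_m_elt[OF v(1) k] mL])
    have zL: "rat_loop \<alpha> (n_elt v z k) \<in> loop_products ?L"
    proof (cases "z = 0")
      case True
      then show ?thesis by (simp add: trivial rat_loop_1 loop_products_1)
    next
      case False
      have max: "maximal_isotropic {c *s v |c. True}"
        using 3 v by (intro line_maximal_isotropic)
      \<comment> \<open>For \<open>p = q = 1\<close> the vectors \<open>v\<close> and
        \<open>sv\<close> span the whole space, so \<open>z\<close> would be zero. A loop of type
        \<open>n\<close> therefore arises only for \<open>p \<noteq> q\<close>.\<close>
      have "CARD('q) \<noteq> 1"
      proof
        assume "CARD('q) = 1"
        then obtain i :: 'p and j :: 'q where ij: "UNIV = {i}" "UNIV = {j}"
          using 3 by (auto simp: card_1_singleton_iff)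
        have "- (cnj (v $ Inl i) * z $ Inl i) + cnj (v $ Inr j) * z $ Inr j = 0"
          using z(1) by (simp add: pq_form_def ij)
        moreover have "cnj (v $ Inl i) * z $ Inl i + cnj (v $ Inr j) * z $ Inr j = 0"
          using z(2) unfolding pq_form_sig_mat sum_UNIV_Plus ij by simp
        ultimately have "cnj (v $ Inl i) * z $ Inl i = 0" "cnj (v $ Inr j) * z $ Inr j = 0"
          by (auto simp: add_eq_0_iff)
        moreover have "v $ Inl i = 0 \<longleftrightarrow> v $ Inr j = 0"
          using v(1) by (auto simp: pq_form_def ij)
        moreover have all: "x = 0" if "x $ Inl i = 0" "x $ Inr j = 0" for x :: "complex ^ ('p + 'q)"
        proof -
          have "x $ a = 0" for a using ij that by (cases a) (metis UNIV_I singletonD)+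
          then show ?thesis by (simp add: vec_eq_iff)
        qed
        moreover have "v $ Inl i \<noteq> 0 \<or> v $ Inr j \<noteq> 0" using all[of v] 3 by blast
        ultimately have "z $ Inl i = 0" "z $ Inr j = 0" by auto
        then show False using all[of z] False by blast
      qed
      then have "rat_loop \<alpha> (n_elt v z k) \<in> ?L"
        using n_loop_in_n_type_loops[OF max 3(1) z False k] 3(2) by auto
      then show ?thesis by (rule loop_products_generator)
    qed
    have "w = b *s v + z" by (simp add: z_def)
    then show ?thesis
      using rat_loop_n_elt_add[OF v(1) _ z(1) k mL bv zL] v(1) by (simp add: pq_form_linear)
  qed
qed

lemma elem_group_loop_products:
  fixes u :: "complex poly ^ ('p::finite + 'q::finite) ^ ('p + 'q)"
  assumes "CARD('p) \<le> CARD('q)" "u \<in> elem_group Z"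
  shows "rat_loop \<alpha> u \<in>
    loop_products (m_type_loops \<alpha> \<union> (if CARD('p) = CARD('q) then {} else n_type_loops \<alpha>))"
  using assms(2)
proof induction
  case one
  show ?case by (simp add: rat_loop_1 loop_products_1)
next
  case (m v k u c)
  then show ?case
    unfolding rat_loop_mult
    by (intro loop_products_mult loop_products_mono[OF rat_loop_m_elt]) auto
next
  case (n v w k u)
  then show ?case
    unfolding rat_loop_mult using assms(1) by (intro loop_products_mult rat_loop_n_elt) auto
qed

section \<open>Loops with a single singularity as polynomial matrices\<close>

lemma adj_form: "pq_form (A *v x) y = pq_form x (adj A *v y)"
proof -
  have "pq_form (A *v x) y = (\<Sum>a\<in>UNIV. \<Sum>b\<in>UNIV. pq_sign a * (cnj (A $ a $ b) * cnj (x $ b)) * y $ a)"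
    by (simp add: pq_form_altdef matrix_vector_mult_def sum_distrib_left sum_distrib_right)
  also have "\<dots> = (\<Sum>b\<in>UNIV. \<Sum>a\<in>UNIV. pq_sign a * (cnj (A $ a $ b) * cnj (x $ b)) * y $ a)"
    by (rule sum.swap)
  also have "\<dots> = pq_form x (adj A *v y)"
    by (simp add: pq_form_altdef matrix_vector_mult_def adj_component sum_distrib_left mult_ac)
  finally show ?thesis .
qed

lemma adj_mult: "adj (A ** B) = adj B ** adj A"
proof -
  have "adj (A ** B) $ a $ b = (adj B ** adj A) $ a $ b" for a b
    by (simp add: adj_component matrix_matrix_mult_def sum_distrib_left sum_distrib_right mult_ac)
  then show ?thesis by (simp add: vec_eq_iff)
qed

lemma adj_1: "adj (mat 1) = mat 1"
  by (simp add: vec_eq_iff adj_component mat_def)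

lemma matrix_inv_adj_isometry:
  assumes "invertible G" "matrix_inv (adj G) = G"
  shows "pq_form (G *v x) (G *v y) = pq_form x y"
proof -
  obtain H where "G ** H = mat 1" "H ** G = mat 1"
    using assms(1) by (auto simp: invertible_def)
  then have "adj H ** adj G = mat 1" "adj G ** adj H = mat 1"
    by (simp_all add: adj_1 flip: adj_mult)
  then have "invertible (adj G)" by (auto simp: invertible_def)
  \<comment> \<open>\<open>matrix_inv\<close> is defined by choice and is an inverse only for an
    invertible matrix, hence the preceding step.\<close>
  then have "adj G ** matrix_inv (adj G) = mat 1"
    unfolding invertible_def matrix_inv_def by (metis (mono_tags, lifting) someI_ex)
  then have "adj G ** G = mat 1" by (simp add: assms(2))
  then show ?thesis by (simp add: adj_form matrix_vector_mul_assoc)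
qed

section \<open>Rational functions with one pole as polynomials in
  \<open>1 / (\<lambda> - \<alpha>)\<close>\<close>

lemma poly_only_root_factorization:
  fixes p :: "complex poly"
  assumes "p \<noteq> 0" "\<And>z. z \<noteq> \<alpha> \<Longrightarrow> poly p z \<noteq> 0"
  obtains c m where "c \<noteq> 0" "p = smult c ([:- \<alpha>, 1:] ^ m)"
proof -
  obtain q where q: "p = [:- \<alpha>, 1:] ^ order \<alpha> p * q" "\<not> [:- \<alpha>, 1:] dvd q"
    using order_decomp[OF assms(1)] by blast
  have "poly q z \<noteq> 0" for z
  proof (cases "z = \<alpha>")
    case True
    then show ?thesis using q(2) by (simp add: poly_eq_0_iff_dvd)
  next
    case False
    then have "poly ([:- \<alpha>, 1:] ^ order \<alpha> p * q) z \<noteq> 0" using assms(2) q(1) by simp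
    then show ?thesis by auto
  qed
  \<comment> \<open>The cofactor has no complex root at all, so it is constant.\<close>
  then have "constant (poly q)" using fundamental_theorem_of_algebra by blast
  then obtain c where "q = [:c:]" by (metis constant_degree degree_eq_zeroE)
  moreover then have "c \<noteq> 0" using q(2) by auto
  ultimately show ?thesis using q(1) that[of c "order \<alpha> p"] by (simp add: mult.commute)
qed

lemma poly_shift_expansion:
  "p = (\<Sum>k\<le>degree p. smult (coeff (p \<circ>\<^sub>p [:\<alpha>, 1:]) k) ([:- \<alpha>, 1:] ^ k))"
  for p :: "complex poly"
proof (rule poly_eq_poly_eq_iff[THEN iffD1], rule ext)
  fix x
  have "poly p x = poly (p \<circ>\<^sub>p [:\<alpha>, 1:]) (x - \<alpha>)" by (simp add: poly_pcompose)
  also have "\<dots> = (\<Sum>k\<le>degree p. coeff (p \<circ>\<^sub>p [:\<alpha>, 1:]) k * (x - \<alpha>) ^ k)"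
    by (subst poly_altdef) (simp add: degree_pcompose)
  finally show "poly p x = poly (\<Sum>k\<le>degree p. smult (coeff (p \<circ>\<^sub>p [:\<alpha>, 1:]) k) ([:- \<alpha>, 1:] ^ k)) x"
    by (simp add: poly_sum)
qed

lemma rat_value_poly_in_inverse:
  assumes pole: "\<And>\<mu>. \<mu> \<noteq> \<alpha> \<Longrightarrow> \<not> rat_pole f \<mu>"
    and lim: "(rat_value f \<longlongrightarrow> l) at_infinity"
  obtains p where "f = rat_of_poly \<alpha> p" "\<And>\<mu>. \<mu> \<noteq> \<alpha> \<Longrightarrow> rat_value f \<mu> = poly p (1 / (\<mu> - \<alpha>))"
    "coeff p 0 = l"
proof -
  define n where "n = fst (quot_of_fract f)"
  define d where "d = snd (quot_of_fract f)"
  have d0: "d \<noteq> 0" by (simp add: d_def)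
  obtain c m where c: "c \<noteq> 0" and d: "d = smult c ([:- \<alpha>, 1:] ^ m)"
    using poly_only_root_factorization[OF d0, of \<alpha>] pole by (auto simp: rat_pole_def d_def)
  have dm: "degree d = m" using c by (simp add: d degree_power_eq)
  have val: "rat_value f = (\<lambda>\<mu>. poly n \<mu> / poly d \<mu>)"
    by (auto simp: rat_value_def n_def d_def)
  \<comment> \<open>A finite limit at infinity bounds the degree of the numerator: otherwise the
    reciprocal tends to zero, and its product with the function would tend both to zero and to
    one.\<close>
  have nd: "degree n \<le> m"
  proof (rule ccontr)
    assume "\<not> ?thesis"
    then have deg: "degree d < degree n" using dm by simp
    then have n0: "n \<noteq> 0" by auto
    have "((\<lambda>\<mu>. (poly d \<mu> / poly n \<mu>) * (poly n \<mu> / poly d \<mu>)) \<longlongrightarrow> 0 * l) at_infinity"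
      using lim deg unfolding val by (intro tendsto_mult poly_divide_tendsto_0_at_infinity) auto
    moreover have "eventually (\<lambda>\<mu>. (poly d \<mu> / poly n \<mu>) * (poly n \<mu> / poly d \<mu>) = 1) at_infinity"
    proof -
      have "eventually (\<lambda>\<mu>. poly n \<mu> \<noteq> 0) at_infinity"
        using filterlim_poly_at_infinity[of n] deg by (intro filterlim_at_infinity_imp_eventually_ne) auto
      moreover have "eventually (\<lambda>\<mu>. poly d \<mu> \<noteq> 0) at_infinity"
        using c by (intro eventually_at_infinityI[of "norm \<alpha> + 1"]) (auto simp: d)
      ultimately show ?thesis by eventually_elim simp
    qed
    ultimately have "((\<lambda>\<mu>::complex. 1::complex) \<longlongrightarrow> 0 * l) at_infinity"
      by (rule Lim_transform_eventually)
    from tendsto_unique[OF trivial_limit_at_infinity this tendsto_const] show False by simp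
  qed
  define a where "a k = coeff (n \<circ>\<^sub>p [:\<alpha>, 1:]) k" for k
  \<comment> \<open>Expanding the numerator about \<open>\<alpha>\<close> and dividing by
    \<open>c (\<lambda> - \<alpha>)^m\<close> gives these terms; \<open>nd\<close> ensures that
    \<open>m - k\<close> is not truncated.\<close>
  define p where "p = (\<Sum>k\<le>degree n. monom (a k / c) (m - k))"
  have n: "n = (\<Sum>k\<le>degree n. smult (a k) ([:- \<alpha>, 1:] ^ k))"
    unfolding a_def by (rule poly_shift_expansion)
  let ?X = "to_fract [:- \<alpha>, 1:] :: ratfun"
  have X: "?X \<noteq> 0" by simp
  have smult: "to_fract (smult b q) = const_rat b * to_fract q" for b :: complex and q
    by (simp add: const_rat_def flip: to_fract_mult)
  have pow: "to_fract (q ^ k) = to_fract q ^ k" for q :: "complex poly" and k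
    by (induction k) simp_all
  have "rat_of_poly \<alpha> p * to_fract d = (\<Sum>k\<le>degree n. const_rat (a k) * ?X ^ k)"
  proof -
    have "inv_lin \<alpha> ^ (m - k) * const_rat (a k / c) * (const_rat c * ?X ^ m) = const_rat (a k) * ?X ^ k"
      if "k \<le> degree n" for k
    proof -
      have "const_rat (a k / c) * const_rat c = const_rat (a k)"
        using c by (simp flip: const_rat_simps(4))
      moreover have "?X ^ m = ?X ^ (m - k) * ?X ^ k" using that nd by (simp flip: power_add)
      moreover have "inv_lin \<alpha> ^ (m - k) * ?X ^ (m - k) = 1"
        using X by (simp add: inv_lin_def flip: power_mult_distrib)
      moreover have "inv_lin \<alpha> ^ (m - k) * const_rat (a k / c) * (const_rat c * (?X ^ (m - k) * ?X ^ k))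
        = (const_rat (a k / c) * const_rat c) * (inv_lin \<alpha> ^ (m - k) * ?X ^ (m - k)) * ?X ^ k"
        by (simp only: mult_ac)
      ultimately show ?thesis by simp
    qed
    then show ?thesis
      by (simp add: p_def rat_of_poly_sum rat_of_poly_monom d smult pow sum_distrib_right)
  qed
  also have "\<dots> = to_fract n"
    by (subst n) (simp add: smult pow)
  finally have eq: "rat_of_poly \<alpha> p * to_fract d = to_fract n" .
  have "f = to_fract n / to_fract d"
    by (simp add: n_def d_def flip: Fract_conv_to_fract)
  also have "\<dots> = rat_of_poly \<alpha> p" using d0 by (simp flip: eq)
  finally have f: "f = rat_of_poly \<alpha> p" .
  have v: "rat_value f \<mu> = poly p (1 / (\<mu> - \<alpha>))" if "\<mu> \<noteq> \<alpha>" for \<mu>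
  proof -
    have "poly n \<mu> = (\<Sum>k\<le>degree n. a k * (\<mu> - \<alpha>) ^ k)"
      by (subst n) (simp add: poly_sum)
    moreover have "a k * (\<mu> - \<alpha>) ^ k / (c * (\<mu> - \<alpha>) ^ m) = a k / c * (1 / (\<mu> - \<alpha>)) ^ (m - k)"
      if "k \<le> degree n" for k
    proof -
      have "(\<mu> - \<alpha>) ^ m = (\<mu> - \<alpha>) ^ (m - k) * (\<mu> - \<alpha>) ^ k" using that nd by (simp flip: power_add)
      then show ?thesis using c \<open>\<mu> \<noteq> \<alpha>\<close> by (simp add: field_simps)
    qed
    ultimately show ?thesis
      by (simp add: val d p_def poly_sum poly_monom sum_divide_distrib)
  qed
  have "(rat_value f \<longlongrightarrow> poly p 0) at_infinity"
  proof -
    have "filterlim (\<lambda>\<mu>. poly [:- \<alpha>, 1:] \<mu>) at_infinity at_infinity"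
      by (rule filterlim_poly_at_infinity) simp
    then have "((\<lambda>\<mu>. inverse (poly [:- \<alpha>, 1:] \<mu>)) \<longlongrightarrow> 0) at_infinity"
      by (rule filterlim_compose[OF tendsto_inverse_0])
    then have "((\<lambda>\<mu>. poly p (inverse (poly [:- \<alpha>, 1:] \<mu>))) \<longlongrightarrow> poly p 0) at_infinity"
      by (rule tendsto_poly)
    moreover have "eventually (\<lambda>\<mu>. poly p (inverse (poly [:- \<alpha>, 1:] \<mu>)) = rat_value f \<mu>) at_infinity"
      by (rule eventually_at_infinityI[of "norm \<alpha> + 1"])
        (subst v, auto simp: divide_inverse)
    ultimately show ?thesis by (rule Lim_transform_eventually)
  qed
  then have "poly p 0 = l" using lim by (rule tendsto_unique[OF trivial_limit_at_infinity])
  then show ?thesis using that f v by (simp add: poly_0_coeff_0)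
qed


section \<open>From identities at real points to polynomial identities\<close>

definition eval_vec :: "complex poly ^ 'n \<Rightarrow> complex \<Rightarrow> complex ^ 'n" where
  "eval_vec x t = (\<chi> a. poly (x $ a) t)"

lemma eval_vec_mult: "eval_vec (P *v x) t = map_matrix (\<lambda>p. poly p t) P *v eval_vec x t"
  by (simp add: eval_vec_def vec_eq_iff matrix_vector_mult_def poly_sum)

lemma poly_map_poly_cnj: "poly (map_poly cnj p) (of_real t) = cnj (poly p (of_real t))"
  by (induction p) (simp_all add: map_poly_pCons)

lemma poly_poly_form:
  "poly (poly_form x y) (of_real t) = pq_form (eval_vec x (of_real t)) (eval_vec y (of_real t))"
  by (simp add: poly_form_def poly_sum poly_map_poly_cnj pq_form_altdef eval_vec_def mult_ac)

text \<open>For real \<open>t\<close> conjugating coefficients amounts to conjugating values, so the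
  hypothesis makes the difference of the two forms vanish at infinitely many points. The value
  \<open>t = 0\<close> corresponds to \<open>\<lambda> = \<infinity>\<close> and is treated
  separately.\<close>

lemma based_isometryI:
  assumes iso: "\<And>t x y. t \<noteq> 0 \<Longrightarrow> pq_form (map_matrix (\<lambda>p. poly p (of_real t)) P *v x)
      (map_matrix (\<lambda>p. poly p (of_real t)) P *v y) = pq_form x y"
    and one: "map_matrix (\<lambda>p. poly p 0) P = mat 1"
  shows "based_isometry P"
proof -
  have "poly_form (P *v x) (P *v y) = poly_form x y" for x y
  proof (rule ccontr)
    let ?d = "poly_form (P *v x) (P *v y) - poly_form x y"
    assume "\<not> ?thesis"
    then have "finite {z. poly ?d z = 0}" by (intro poly_roots_finite) simp
    moreover have "of_real ` {0::real<..} \<subseteq> {z. poly ?d z = 0}"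
      using iso by (auto simp: poly_poly_form eval_vec_mult)
    ultimately have "finite (complex_of_real ` {0<..})" by (rule rev_finite_subset)
    then have "finite {0::real<..}" by (rule finite_imageD) (simp add: inj_on_def)
    then show False by (simp add: infinite_Ioi)
  qed
  moreover have "coeff_vec x 0 = eval_vec x 0" for x :: "complex poly ^ ('a + 'b)"
    by (simp add: coeff_vec_def eval_vec_def poly_0_coeff_0)
  then have "coeff_vec (P *v x) 0 = coeff_vec x 0" for x
    by (simp add: eval_vec_mult one)
  ultimately show ?thesis by (simp add: based_isometry_def)
qed

lemma single_singularity_loop_polynomial:
  fixes g :: "ratfun ^ ('p::finite + 'q::finite) ^ ('p + 'q)" and \<alpha> :: real
  assumes g: "g \<in> neg_loops_U" and sing: "{\<mu>. loop_singularity g \<mu>} = {complex_of_real \<alpha>}"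
  obtains P where "g = rat_loop (of_real \<alpha>) P" "based_isometry P"
proof -
  have reg: "\<not> loop_singularity g \<mu>" if "\<mu> \<noteq> of_real \<alpha>" for \<mu> using sing that by blast
  have lim: "((\<lambda>\<mu>. rat_value (g $ a $ b) \<mu>) \<longlongrightarrow> mat 1 $ a $ b) at_infinity" for a b
  proof -
    have "(loop_value g \<longlongrightarrow> mat 1) at_infinity"
      using g by (simp add: neg_loops_U_def neg_loops_GL_def)
    then have "((\<lambda>\<mu>. loop_value g \<mu> $ a $ b) \<longlongrightarrow> mat 1 $ a $ b) at_infinity"
      by (intro tendsto_vec_nth)
    then show ?thesis by (simp add: loop_value_def)
  qed
  have "\<exists>p. g $ a $ b = rat_of_poly (of_real \<alpha>) p \<and>
      (\<forall>\<mu>. \<mu> \<noteq> of_real \<alpha> \<longrightarrow> rat_value (g $ a $ b) \<mu> = poly p (1 / (\<mu> - of_real \<alpha>))) \<and>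
      coeff p 0 = mat 1 $ a $ b" for a b
  proof -
    have "\<not> rat_pole (g $ a $ b) \<mu>" if "\<mu> \<noteq> of_real \<alpha>" for \<mu>
      using reg[OF that] by (auto simp: loop_singularity_def loop_pole_def)
    from rat_value_poly_in_inverse[OF this lim] show ?thesis by metis
  qed
  then obtain p where p: "g $ a $ b = rat_of_poly (of_real \<alpha>) (p a b)"
      "\<mu> \<noteq> of_real \<alpha> \<Longrightarrow> rat_value (g $ a $ b) \<mu> = poly (p a b) (1 / (\<mu> - of_real \<alpha>))"
      "coeff (p a b) 0 = mat 1 $ a $ b" for a b \<mu>
    by metis
  define P where "P = (\<chi> a b. p a b)"
  have "g = rat_loop (of_real \<alpha>) P" by (simp add: rat_loop_def P_def vec_eq_iff p(1))
  moreover have "based_isometry P"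
  proof (rule based_isometryI)
    show "map_matrix (\<lambda>p. poly p 0) P = mat 1"
      by (simp add: vec_eq_iff P_def poly_0_coeff_0 p(3))
    fix t :: real and x y :: "complex ^ ('p + 'q)"
    assume t: "t \<noteq> 0"
    \<comment> \<open>Nonzero real \<open>t\<close> correspond to real
      \<open>\<mu> \<noteq> \<alpha>\<close>. Such a point is regular and its own conjugate, so the
      reality condition says that the single matrix \<open>g(\<mu>)\<close> is an isometry.\<close>
    define \<mu> where "\<mu> = complex_of_real (\<alpha> + 1 / t)"
    have \<mu>: "\<mu> \<noteq> of_real \<alpha>" "cnj \<mu> = \<mu>" "1 / (\<mu> - of_real \<alpha>) = of_real t"
      using t by (auto simp: \<mu>_def)
    have G: "loop_value g \<mu> = map_matrix (\<lambda>p. poly p (of_real t)) P"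
      by (simp add: loop_value_def vec_eq_iff P_def p(2)[OF \<mu>(1)] \<mu>(3))
    have "matrix_inv (adj (loop_value g \<mu>)) = loop_value g \<mu>"
      using g reg[OF \<mu>(1)] \<mu>(2) unfolding neg_loops_U_def by auto
    moreover have "invertible (loop_value g \<mu>)"
      using reg[OF \<mu>(1)] by (auto simp: loop_singularity_def loop_zero_def)
    ultimately show "pq_form (map_matrix (\<lambda>p. poly p (of_real t)) P *v x)
        (map_matrix (\<lambda>p. poly p (of_real t)) P *v y) = pq_form x y"
      unfolding G[symmetric] by (intro matrix_inv_adj_isometry)
  qed
  ultimately show ?thesis by (rule that)
qed

theorem theorem3p5:
  fixes g :: "ratfun ^ ('p::finite + 'q::finite) ^ ('p + 'q)" and \<alpha> :: real
  assumes "CARD('p) \<le> CARD('q)"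
    and "g \<in> neg_loops_U"
    and "{\<mu>. loop_singularity g \<mu>} = {complex_of_real \<alpha>}"
  shows "(CARD('p) = CARD('q) \<longrightarrow>
            (\<exists>gs. set gs \<subseteq> m_type_loops (complex_of_real \<alpha>) \<and> g = loop_product gs))
       \<and> (CARD('p) \<noteq> CARD('q) \<longrightarrow>
            (\<exists>gs. set gs \<subseteq> m_type_loops (complex_of_real \<alpha>) \<union> n_type_loops (complex_of_real \<alpha>)
               \<and> g = loop_product gs))"
proof -
  obtain P where P: "g = rat_loop (of_real \<alpha>) P" "based_isometry P"
    using single_singularity_loop_polynomial[OF assms(2,3)] .
  have "g \<in> loop_products (m_type_loops (of_real \<alpha>) \<union>
      (if CARD('p) = CARD('q) then {} else n_type_loops (of_real \<alpha>)))"
    unfolding P(1)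
    by (rule elem_group_loop_products[OF assms(1) based_isometry_in_elem_group[OF assms(1) P(2)]])
  then show ?thesis by (auto simp: loop_products_def split: if_splits)
qed

end
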